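(* Let $d\ge2$ be an integer, $\beta\ge\frac{1}{2\log2}$, and let $\mathcal{X}=\{x_k\}_{k=1}^s\subseteq[-\frac12,\frac12)^d$ be a set of $s$ distinct points. Suppose $m\ge4s$ (real), there is $0<\tau\le\frac{1}{4d}$ such that $\frac{2\beta d\nu}{\tau}\le m$, where $\nu:=\nu_\infty(\tau,\mathcal{X})$, and $\mathcal{X}$ locally consists of hyperplanes with parameters $(\infty,\frac{\nu}{m},r,\eta)$ such that $\eta\le\frac{r+1}{2m}$. Then $$\sigma_{\min}(\mathcal{F}_{Q_m,\mathcal{X}})\ge\sqrt{\frac2s}\,\Big(1-\frac12e^{1/(2\beta)}\Big)^{\nu/2}\sqrt{|Q_{m/(2r+2)}|}\ \frac{1}{2^{r/2}}\Big(\frac{2m\eta}{r+1}\Big)^r.$$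
   Context: $Q_m=\{x\in\mathbb{R}^d:|x|_\infty\le m\}$. For compact $\Omega\subset\mathbb{R}^d$, $|\Omega|$ is its Lebesgue measure. $\mathcal{F}_{\Omega,\mathcal{X}}:\mathbb{C}^s\to L^2(\Omega)$ is $(\mathcal{F}_{\Omega,\mathcal{X}}u)(\omega)=\sum_{k=1}^s u_ke^{-2\pi i\omega\cdot x_k}$, and $\sigma_{\min}(\mathcal{F}_{\Omega,\mathcal{X}})$ is the minimum of $\|\mathcal{F}_{\Omega,\mathcal{X}}u\|_{L^2(\Omega)}$ over $u\in\mathbb{C}^s$ with $|u|_2=1$. $\mathcal{N}_p(x,\tau,\mathcal{X})=\{x'\in\mathcal{X}:|x'-x|_p\le\tau\}$ with $|\cdot|_p$ the $\ell^p$ norm on $\mathbb{R}^d$, and the local sparsity is $\nu_p(\tau,\mathcal{X})=\max_{x\in\mathcal{X}}|\mathcal{N}_p(x,\tau,\mathcal{X})|$. A finite set $\mathcal{U}$ consists of $r$ hyperplanes relative to $x\in\mathcal{U}$ if there are (affine) hyperplanes $\mathcal{H}_1,\dots,\mathcal{H}_r\subset\mathbb{R}^d$, none containing $x$, with $\mathcal{U}\setminus\{x\}\subseteq\mathcal{H}_1\cup\cdots\cup\mathcal{H}_r$. $\mathcal{X}$ locally consists of hyperplanes with parameters $(p,\rho,r,\eta)$, $\eta>0$, if for each $x\in\mathcal{X}$ the set $\mathcal{N}_p(x,\rho,\mathcal{X})$ consists of at most $r$ hyperplanes relative to $x$, and the $\ell^2$ distance between $x$ and each of these hyperplanes is at least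 $\eta$. *)

theory Defs
  imports "HOL-Analysis.Analysis"
begin

(* Meaningful for 1 \<le> p \<le> \<infinity>; for p < 1 this is not a norm. *)
definition lp_norm :: "ereal \<Rightarrow> real ^ 'n::finite \<Rightarrow> real" where
  "lp_norm p x = (if p = \<infinity> then infnorm x
     else (\<Sum>i\<in>UNIV. \<bar>x $ i\<bar> powr real_of_ereal p) powr (1 / real_of_ereal p))"

definition cube :: "real \<Rightarrow> (real ^ 'n::finite) set" where
  "cube m = {x. lp_norm \<infinity> x \<le> m}"

(* The finite index type 's stands for {1..s}; the set of nodes is range x. *)
definition fourier_op ::
  "('s::finite \<Rightarrow> real ^ 'n::finite) \<Rightarrow> complex ^ 's \<Rightarrow> real ^ 'n \<Rightarrow> complex" where
  "fourier_op x u \<omega> =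
     (\<Sum>k\<in>UNIV. u $ k * exp (- 2 * complex_of_real pi * \<i> * complex_of_real (\<omega> \<bullet> x k)))"

definition L2_norm_on :: "(real ^ 'n::finite) set \<Rightarrow> (real ^ 'n \<Rightarrow> complex) \<Rightarrow> real" where
  "L2_norm_on \<Omega> f = sqrt (LINT \<omega>:\<Omega>|lebesgue. (cmod (f \<omega>))\<^sup>2)"

(* For compact \<Omega> the infimum is a minimum, see sigma_min_attained below. *)
definition sigma_min :: "(real ^ 'n::finite) set \<Rightarrow> ('s::finite \<Rightarrow> real ^ 'n) \<Rightarrow> real" where
  "sigma_min \<Omega> x = (INF u\<in>{u. norm u = 1}. L2_norm_on \<Omega> (fourier_op x u))"

definition lp_nbhd ::
  "ereal \<Rightarrow> real ^ 'n::finite \<Rightarrow> real \<Rightarrow> (real ^ 'n) set \<Rightarrow> (real ^ 'n) set" where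
  "lp_nbhd p x \<tau> X = {x' \<in> X. lp_norm p (x' - x) \<le> \<tau>}"

definition local_sparsity :: "ereal \<Rightarrow> real \<Rightarrow> (real ^ 'n::finite) set \<Rightarrow> nat" where
  "local_sparsity p \<tau> X = Max ((\<lambda>x. card (lp_nbhd p x \<tau> X)) ` X)"

definition hyperplane :: "(real ^ 'n::finite) set \<Rightarrow> bool" where
  "hyperplane H \<longleftrightarrow> (\<exists>a b. a \<noteq> 0 \<and> H = {y. a \<bullet> y = b})"

(* U consists of the r hyperplanes H 1, ..., H r relative to x. The hyperplanes are kept as an
   argument because the next definition also constrains their distances to x. *)
definition consists_of_hyperplanes ::
  "nat \<Rightarrow> (nat \<Rightarrow> (real ^ 'n::finite) set) \<Rightarrow> real ^ 'n \<Rightarrow> (real ^ 'n) set \<Rightarrow> bool" where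
  "consists_of_hyperplanes r H x U \<longleftrightarrow>
     finite U \<and> x \<in> U \<and>
     (\<forall>i\<in>{1..r}. hyperplane (H i) \<and> x \<notin> H i) \<and>
     U - {x} \<subseteq> (\<Union>i\<in>{1..r}. H i)"

definition locally_hyperplanes ::
  "ereal \<Rightarrow> real \<Rightarrow> nat \<Rightarrow> real \<Rightarrow> (real ^ 'n::finite) set \<Rightarrow> bool" where
  "locally_hyperplanes p \<rho> r \<eta> X \<longleftrightarrow>
     \<eta> > 0 \<and>
     (\<forall>x\<in>X. \<exists>q\<le>r. \<exists>H. consists_of_hyperplanes q H x (lp_nbhd p x \<rho> X) \<and>
        (\<forall>i\<in>{1..q}. \<eta> \<le> infdist x (H i)))"

lemma continuous_on_L2_norm_fourier_op:
  fixes x :: "'s::finite \<Rightarrow> real ^ 'n::finite"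
  assumes "compact \<Omega>"
  shows "continuous_on UNIV (\<lambda>u. L2_norm_on \<Omega> (fourier_op x u))"
proof -
  define e where "e k \<omega> = exp (- 2 * complex_of_real pi * \<i> * complex_of_real (\<omega> \<bullet> x k))"
    for k and \<omega> :: "real ^ 'n"
  define g where "g j k \<omega> = e j \<omega> * cnj (e k \<omega>)" for j k \<omega>
  have int: "set_integrable lebesgue \<Omega> (g j k)" for j k
  proof -
    have "set_integrable lborel \<Omega> (g j k)"
      unfolding set_integrable_def g_def e_def using assms
      by (intro borel_integrable_compact continuous_intros)
    then show ?thesis
      using integrable_completion[of "\<lambda>\<omega>. indicat_real \<Omega> \<omega> *\<^sub>R g j k \<omega>" lborel]
      unfolding set_integrable_def by (simp add: borel_measurable_integrable)
  qed
  have sq: "complex_of_real ((cmod (fourier_op x u \<omega>))\<^sup>2)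
      = (\<Sum>j\<in>UNIV. \<Sum>k\<in>UNIV. (u $ j * cnj (u $ k)) * g j k \<omega>)" for u \<omega>
    unfolding complex_norm_square fourier_op_def g_def e_def[symmetric]
    by (simp add: sum_product ac_simps)
  have "complex_of_real (LINT \<omega>:\<Omega>|lebesgue. (cmod (fourier_op x u \<omega>))\<^sup>2)
      = (\<Sum>j\<in>UNIV. \<Sum>k\<in>UNIV. (u $ j * cnj (u $ k)) * (LINT \<omega>:\<Omega>|lebesgue. g j k \<omega>))" for u
  proof -
    have "complex_of_real (LINT \<omega>:\<Omega>|lebesgue. (cmod (fourier_op x u \<omega>))\<^sup>2)
        = (LINT \<omega>:\<Omega>|lebesgue. complex_of_real ((cmod (fourier_op x u \<omega>))\<^sup>2))"
      by (rule set_integral_complex_of_real[symmetric])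
    also have "\<dots> = (LINT \<omega>|lebesgue. (\<Sum>j\<in>UNIV. \<Sum>k\<in>UNIV.
        (u $ j * cnj (u $ k)) * (indicat_real \<Omega> \<omega> *\<^sub>R g j k \<omega>)))"
      unfolding sq set_lebesgue_integral_def
      by (simp add: sum_distrib_left mult.left_commute scaleR_conv_of_real)
    also have "\<dots> = (\<Sum>j\<in>UNIV. \<Sum>k\<in>UNIV.
        (u $ j * cnj (u $ k)) * (LINT \<omega>:\<Omega>|lebesgue. g j k \<omega>))"
    proof -
      define h where "h j k \<omega> = indicat_real \<Omega> \<omega> *\<^sub>R g j k \<omega>" for j k \<omega>
      have "integrable lebesgue (h j k)" for j k
        using int[of j k] unfolding set_integrable_def h_def .
      then show ?thesis
        unfolding set_lebesgue_integral_def h_def[symmetric]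
        by (simp add: Bochner_Integration.integral_sum)
    qed
    finally show ?thesis .
  qed
  then have "(LINT \<omega>:\<Omega>|lebesgue. (cmod (fourier_op x u \<omega>))\<^sup>2)
      = Re (\<Sum>j\<in>UNIV. \<Sum>k\<in>UNIV. (u $ j * cnj (u $ k)) * (LINT \<omega>:\<Omega>|lebesgue. g j k \<omega>))" for u
    by (metis Re_complex_of_real)
  then show ?thesis
    unfolding L2_norm_on_def by (simp only:) (intro continuous_intros)
qed

lemma sigma_min_attained:
  fixes x :: "'s::finite \<Rightarrow> real ^ 'n::finite"
  assumes "compact \<Omega>"
  shows "\<exists>u. norm u = 1 \<and> sigma_min \<Omega> x = L2_norm_on \<Omega> (fourier_op x u)"
    and "norm u = 1 \<Longrightarrow> sigma_min \<Omega> x \<le> L2_norm_on \<Omega> (fourier_op x u)"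
proof -
  let ?S = "{u :: complex ^ 's. norm u = 1}"
  have S: "?S = sphere 0 1" by auto
  have "axis undefined 1 \<in> ?S" by simp
  then have ne: "?S \<noteq> {}" by blast
  obtain v where v: "v \<in> ?S"
    "\<And>w. w \<in> ?S \<Longrightarrow> L2_norm_on \<Omega> (fourier_op x v) \<le> L2_norm_on \<Omega> (fourier_op x w)"
    using continuous_attains_inf[of ?S "\<lambda>u. L2_norm_on \<Omega> (fourier_op x u)"] ne
      continuous_on_subset[OF continuous_on_L2_norm_fourier_op[OF assms]]
    unfolding S by (metis compact_sphere subset_UNIV)
  have eq: "sigma_min \<Omega> x = L2_norm_on \<Omega> (fourier_op x v)"
    unfolding sigma_min_def using v by (intro cInf_eq_minimum) auto
  show "\<exists>u. norm u = 1 \<and> sigma_min \<Omega> x = L2_norm_on \<Omega> (fourier_op x u)"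
    using eq v(1) by auto
  show "norm u = 1 \<Longrightarrow> sigma_min \<Omega> x \<le> L2_norm_on \<Omega> (fourier_op x u)"
    using eq v(2) by auto
qed

end

theory Submission
  imports Defs
begin

text \<open>
  The proof is by duality, phrased in the frequency variable. For a coefficient vector \<open>u\<close> let
  \<open>f\<^sub>u(\<omega>) = \<Sum>\<^sub>k u\<^sub>k e\<^bsup>-2\<pi>i\<omega>\<cdot>x\<^sub>k\<^esup>\<close>. A finite combination of translations by vectors in \<open>cube M\<close> maps
  \<open>f\<^sub>u\<close> to \<open>f\<^sub>p\<^sub>u\<close>, where \<open>p\<close> is the exponential sum with these frequencies, and it maps the \<open>L\<^sup>2\<close> norm
  on \<open>cube (R + M)\<close> to the one on \<open>cube R\<close> with operator norm at most the sum \<open>B\<close> of the moduli of the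
  coefficients. This is the notion of a multiplier with band \<open>M\<close> and bound \<open>B\<close>; in a product of
  multipliers the bands add and the bounds multiply. If \<open>p\<close> is 1 at one node and 0 at all others, then
  \<open>f\<^sub>p\<^sub>u\<close> is a single exponential, so \<open>|u\<^sub>k|\<^sup>2 |cube R| \<le> B\<^sup>2 \<parallel>f\<^sub>u\<parallel>\<^sup>2\<close> with the norm on \<open>cube (R + M)\<close>, and
  summing over the \<open>s\<close> nodes gives the lower bound \<open>sqrt (|cube R| / s) / B\<close> for the least singular
  value. It is applied with \<open>R = m / (2 r + 2)\<close>.

  It remains to annihilate all nodes but one, \<open>x\<close>, with \<open>m - R\<close> as the total band. Distances are in
  the maximum norm.

  Nodes within \<open>\<nu>/m\<close> of \<open>x\<close> lie on at most \<open>r\<close> hyperplanes. A sine in the normal direction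
  vanishes on such a hyperplane, has two frequencies, and costs the band \<open>R\<close> and the bound
  \<open>(r + 1) / (2 m \<eta>)\<close> (\<open>hyperplane_multiplier\<close>).

  There are at most \<open>\<nu> - 1\<close> nodes at a distance between \<open>\<nu>/m\<close> and \<open>\<tau>\<close>. They are far enough for a sine in
  one coordinate to have a zero at the node and a maximum at \<open>x\<close>, which costs the
  band \<open>m / (4 \<nu>)\<close> and the bound 1 (\<open>point_multiplier\<close>).

  The nodes beyond \<open>\<tau>\<close> are coloured with \<open>\<nu>\<close> colours so that each colour class is \<open>\<tau>\<close>-separated
  (\<open>greedy_coloring\<close>), and it stays so when \<open>x\<close> is added. Each class is annihilated at once by
  \<open>separated_interpolation\<close>, with band \<open>M\<close> and bound \<open>(1 - d / (4 M\<^sup>2 \<tau>\<^sup>2))\<^bsup>-1/2\<^esup>\<close>. This rests on an Ingham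
  type inequality (\<open>ingham_weights\<close>): there are non-negative weights of mass at most 1 on finitely many
  frequencies in \<open>cube M\<close> for which the exponentials of a \<open>\<tau>\<close>-separated set satisfy a lower Riesz bound
  with the constant \<open>1 - d / (4 M\<^sup>2 \<tau>\<^sup>2)\<close>. The weights are \<open>(1 - |\<omega>|\<^sup>2/M\<^sup>2)\<^sub>+\<close> times the power spectrum of the
  first Dirichlet eigenfunction of a cube of side \<open>\<tau>\<close>: translates of that function to separated points
  have disjoint supports, and the constant compares \<open>M\<close> with its eigenvalue.

  One class receives \<open>M = m / (2 \<nu>)\<close>, the other \<open>\<nu> - 1\<close> classes \<open>M = m / (4 \<nu>)\<close>. With
  \<open>\<epsilon> = d \<nu> / (m \<tau>) \<le> 1 / (2 \<beta>) \<le> ln 2\<close> the squared bounds are at most \<open>1 / (1 - \<epsilon>\<^sup>2/2)\<close> and \<open>1 / (1 - 2 \<epsilon>\<^sup>2)\<close>,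
  because \<open>d \<ge> 2\<close>, and elementary estimates of the exponential function compare them with
  \<open>1 / (2 - e\<^bsup>1/(2\<beta>)\<^esup>)\<close> and \<open>2 / (2 - e\<^bsup>1/(2\<beta>)\<^esup>)\<close>. The first one yields the factor \<open>sqrt 2\<close> of the theorem.
\<close>

section \<open>Fejer means of cosine series\<close>

definition fejer_weight :: "nat \<Rightarrow> int \<Rightarrow> real" where
  "fejer_weight N n = 1 - \<bar>real_of_int n\<bar> / real N"

lemma fejer_weight_bounds:
  assumes "n \<in> {- int N..int N}"
  shows "0 \<le> fejer_weight N n" "fejer_weight N n \<le> 1"
proof -
  have "\<bar>real_of_int n\<bar> \<le> real N" using assms by auto
  then show "0 \<le> fejer_weight N n" by (cases "N = 0") (auto simp: fejer_weight_def field_simps)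
  show "fejer_weight N n \<le> 1" by (simp add: fejer_weight_def)
qed

definition fejer :: "nat \<Rightarrow> real \<Rightarrow> real" where
  "fejer N s = (\<Sum>n=-int N..int N. fejer_weight N n * cos (of_int n * s))"

lemma sum_int_symmetric_Suc:
  fixes f :: "int \<Rightarrow> 'a::comm_monoid_add"
  shows "(\<Sum>n=-int (Suc N)..int (Suc N). f n)
    = (\<Sum>n=-int N..int N. f n) + (f (int (Suc N)) + f (- int (Suc N)))"
proof -
  have "{-int (Suc N)..int (Suc N)} = insert (int (Suc N)) (insert (- int (Suc N)) {-int N..int N})"
    by auto
  then show ?thesis by (simp add: ac_simps)
qed

lemma dirichlet_kernel_times:
  "(1 - cos s) * (\<Sum>n=-int N..int N. cos (of_int n * s)) = cos (real N * s) - cos ((real N + 1) * s)"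
proof (induction N)
  case (Suc N)
  have "cos (real N * s) + cos ((real N + 2) * s) = 2 * cos s * cos ((real N + 1) * s)"
    using cos_plus_cos[of "(real N + 2) * s" "real N * s"] by (simp add: algebra_simps add_divide_distrib)
  moreover have "cos (of_int (int (Suc N)) * s) = cos ((real N + 1) * s)"
    "cos (of_int (- int (Suc N)) * s) = cos ((real N + 1) * s)"
    using cos_minus[of "(real N + 1) * s"] by (simp_all add: algebra_simps)
  ultimately show ?case
    unfolding sum_int_symmetric_Suc distrib_left Suc by (simp add: algebra_simps)
qed simp

text \<open>The closed form of the Fejer kernel without division; it yields positivity and the decay away
  from the multiples of \<open>2\<pi>\<close>.\<close>
lemma fejer_times:
  assumes "N > 0"
  shows "(1 - cos s) * fejer N s = (1 - cos (real N * s)) / real N"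
proof -
  define G where "G N = (\<Sum>n=-int N..int N. (real N - \<bar>real_of_int n\<bar>) * cos (of_int n * s))" for N :: nat
  have "(1 - cos s) * G N = 1 - cos (real N * s)" for N
  proof (induction N)
    case 0
    then show ?case by (simp add: G_def)
  next
    case (Suc N)
    have "G (Suc N) = G N + (\<Sum>n=-int N..int N. cos (of_int n * s))"
      unfolding G_def sum_int_symmetric_Suc by (simp add: sum.distrib[symmetric] algebra_simps)
    then have "(1 - cos s) * G (Suc N) = (1 - cos (real N * s)) + (cos (real N * s) - cos ((real N + 1) * s))"
      using Suc dirichlet_kernel_times[of s N] by (simp add: algebra_simps)
    then show ?case by (simp add: algebra_simps)
  qed
  moreover have "G N = real N * fejer N s"
    unfolding G_def fejer_def sum_distrib_left
    using assms by (intro sum.cong) (simp_all add: fejer_weight_def field_simps)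
  ultimately have "real N * ((1 - cos s) * fejer N s) = 1 - cos (real N * s)" by (metis mult.left_commute)
  then show ?thesis using assms by (simp add: field_simps)
qed

lemma fejer_nonneg:
  assumes "N > 0"
  shows "0 \<le> fejer N s"
proof (cases "cos s = 1")
  case True
  then obtain k where "s = of_int k * (2 * pi)" by (auto simp: cos_one_2pi_int)
  then have "cos (of_int n * s) = 1" for n :: int
    by (metis cos_int_2pin mult.assoc mult.commute of_int_mult)
  then show ?thesis
    unfolding fejer_def using fejer_weight_bounds(1)[of _ N] by (auto intro!: sum_nonneg)
next
  case False
  then have "1 - cos s > 0" using cos_le_one[of s] by linarith
  moreover have "0 \<le> (1 - cos s) * fejer N s" using fejer_times[OF assms] assms by simp
  ultimately show ?thesis by (simp add: zero_le_mult_iff)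
qed

text \<open>The even, \<open>2\<pi>\<close>-periodic extension of \<open>f\<close> is averaged against the folded kernel
  \<open>(F\<^sub>N(x - t) + F\<^sub>N(x + t)) / 2\<close>. This kernel is positive with total mass \<open>\<pi>\<close>, and \<open>(cos x - cos t)\<^sup>2\<close>
  times it is \<open>O(1/N)\<close> because \<open>(cos x - cos t)\<^sup>2 = (1 - cos (x - t)) (1 - cos (x + t))\<close>. Since the
  cosine is injective on \<open>[0, \<pi>]\<close>, the mass concentrates at \<open>x\<close>, as in Korovkin's theorem.\<close>
theorem fejer_cosine_series:
  assumes cont: "continuous_on {0..pi} f" and x: "x \<in> {0..pi}"
  shows "(\<lambda>N. \<Sum>n=-int N..int N. fejer_weight N n * integral {0..pi} (\<lambda>t. f t * cos (of_int n * t)) * cos (of_int n * x))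
    \<longlonglongrightarrow> pi * f x"
proof -
  define K where "K N t = (fejer N (x - t) + fejer N (x + t)) / 2" for N t
  have K_eq: "K N t = (\<Sum>n=-int N..int N. fejer_weight N n * cos (of_int n * x) * cos (of_int n * t))" for N t
    unfolding K_def fejer_def sum.distrib[symmetric] sum_divide_distrib
    by (intro sum.cong) (auto simp: ring_distribs cos_diff cos_add)
  have contK: "continuous_on S (K N)" for S N
    unfolding K_eq by (intro continuous_intros)
  have K_nonneg: "0 \<le> K N t" if "N > 0" for N t
    using fejer_nonneg[OF that] by (simp add: K_def)
  have K_mom: "(cos x - cos t)\<^sup>2 * K N t \<le> 4 / real N" if "N > 0" for N t
  proof -
    have sq: "(cos x - cos t)\<^sup>2 = (1 - cos (x - t)) * (1 - cos (x + t))"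
    proof -
      have s: "(sin x)\<^sup>2 = 1 - (cos x)\<^sup>2" "(sin t)\<^sup>2 = 1 - (cos t)\<^sup>2" by (auto simp: sin_squared_eq)
      have "(1 - cos (x - t)) * (1 - cos (x + t)) = (1 - cos x * cos t)\<^sup>2 - (sin x)\<^sup>2 * (sin t)\<^sup>2"
        unfolding cos_diff cos_add by algebra
      also have "\<dots> = (cos x - cos t)\<^sup>2" unfolding s by algebra
      finally show ?thesis by simp
    qed
    have bd: "(1 - cos a) * fejer N a * (1 - cos b) \<le> 4 / real N" for a b :: real
    proof -
      have "1 - cos (real N * a) \<le> 2" "1 - cos b \<le> 2" "0 \<le> 1 - cos b" "0 \<le> 1 - cos (real N * a)"
        using cos_ge_minus_one[of "real N * a"] cos_ge_minus_one[of b] by simp_all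
      then have "(1 - cos (real N * a)) * (1 - cos b) \<le> 2 * 2" by (intro mult_mono) auto
      then have "(1 - cos (real N * a)) * (1 - cos b) / real N \<le> 4 / real N"
        by (intro divide_right_mono) auto
      then show ?thesis using that by (simp add: fejer_times)
    qed
    have fold: "(A * F * B + B * G * A) / 2 = A * B * ((F + G) / 2)" for A B F G :: real
      by (simp add: field_simps)
    have avg: "(p + q) / 2 \<le> c" if "p \<le> c" "q \<le> c" for p q c :: real using that by simp
    from avg[OF bd[of "x - t" "x + t"] bd[of "x + t" "x - t"]]
    have "((1 - cos (x - t)) * fejer N (x - t) * (1 - cos (x + t))
      + (1 - cos (x + t)) * fejer N (x + t) * (1 - cos (x - t))) / 2 \<le> 4 / real N" .
    also have "((1 - cos (x - t)) * fejer N (x - t) * (1 - cos (x + t))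
      + (1 - cos (x + t)) * fejer N (x + t) * (1 - cos (x - t))) / 2 = (cos x - cos t)\<^sup>2 * K N t"
      unfolding sq K_def by (rule fold)
    finally show ?thesis .
  qed
  have K_mass: "integral {0..pi} (K N) = pi" for N
  proof -
    have cosint: "integral {0..pi} (\<lambda>t. cos (of_int n * t)) = (if n = 0 then pi else 0)" for n :: int
    proof (cases "n = 0")
      case False
      have "((\<lambda>t. cos (of_int n * t)) has_integral (sin (of_int n * pi) / of_int n - sin (of_int n * 0) / of_int n)) {0..pi}"
        using False by (intro fundamental_theorem_of_calculus)
          (auto intro!: derivative_eq_intros simp: has_real_derivative_iff_has_vector_derivative[symmetric])
      then show ?thesis using False by (auto simp: integral_unique mult.commute)
    qed simp
    have "integral {0..pi} (K N)
      = (\<Sum>n=-int N..int N. integral {0..pi} (\<lambda>t. fejer_weight N n * cos (of_int n * x) * cos (of_int n * t)))"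
      unfolding K_eq by (intro integral_sum integrable_continuous_real continuous_intros) auto
    also have "\<dots> = (\<Sum>n=-int N..int N. if n = 0 then pi else 0)"
      by (intro sum.cong) (auto simp: cosint fejer_weight_def)
    finally show ?thesis by simp
  qed
  define S where "S N = integral {0..pi} (\<lambda>t. f t * K N t)" for N
  have S_eq: "(\<Sum>n=-int N..int N. fejer_weight N n * integral {0..pi} (\<lambda>t. f t * cos (of_int n * t)) * cos (of_int n * x)) = S N" for N
  proof -
    have "S N = integral {0..pi} (\<lambda>t. \<Sum>n=-int N..int N. fejer_weight N n * cos (of_int n * x) * (f t * cos (of_int n * t)))"
      unfolding S_def K_eq sum_distrib_left by (simp add: mult_ac)
    also have "\<dots> = (\<Sum>n=-int N..int N. integral {0..pi} (\<lambda>t. fejer_weight N n * cos (of_int n * x) * (f t * cos (of_int n * t))))"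
      by (intro integral_sum integrable_continuous_real continuous_intros cont) auto
    finally show ?thesis unfolding integral_mult_right by (simp add: mult_ac)
  qed
  have "S \<longlonglongrightarrow> pi * f x"
  proof (rule LIMSEQ_I)
    fix e :: real assume "e > 0"
    define \<zeta> where "\<zeta> = e / (2 * pi)"
    have "\<zeta> > 0" using \<open>e > 0\<close> by (simp add: \<zeta>_def)
    \<comment> \<open>Near \<open>x\<close> continuity bounds the difference by \<open>\<zeta>\<close>; away from \<open>x\<close> compactness bounds its quotient
      by the test function.\<close>
    obtain C where C: "C \<ge> 0" "\<And>t. t \<in> {0..pi} \<Longrightarrow> \<bar>f t - f x\<bar> \<le> \<zeta> + C * (cos x - cos t)\<^sup>2"
    proof -
      obtain r where r: "r > 0" "\<And>t. t \<in> {0..pi} \<Longrightarrow> dist t x < r \<Longrightarrow> dist (f t) (f x) < \<zeta>"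
        using cont x \<open>\<zeta> > 0\<close> unfolding continuous_on_iff by meson
      define T where "T = {0..pi} - ball x r"
      have T: "compact T" unfolding T_def by (intro compact_diff) auto
      have pos: "(cos x - cos t)\<^sup>2 > 0" if "t \<in> T" for t
        using that r(1) cos_inj_pi[of x t] x by (auto simp: T_def)
      define q where "q t = \<bar>f t - f x\<bar> / (cos x - cos t)\<^sup>2" for t
      have "continuous_on T q"
        unfolding q_def using pos
        by (intro continuous_intros continuous_on_subset[OF cont]) (auto simp: T_def)
      then have "bounded (q ` T)"
        using compact_continuous_image[OF _ T] compact_imp_bounded by blast
      then obtain C where C: "C > 0" "\<And>t. t \<in> T \<Longrightarrow> \<bar>q t\<bar> \<le> C"
        unfolding bounded_pos by auto
      have "\<bar>f t - f x\<bar> \<le> \<zeta> + C * (cos x - cos t)\<^sup>2" if "t \<in> {0..pi}" for t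
      proof (cases "t \<in> T")
        case True
        have "q t \<le> C" using C(2)[OF True] by simp
        then have "\<bar>f t - f x\<bar> \<le> C * (cos x - cos t)\<^sup>2"
          using pos[OF True] by (simp add: q_def pos_divide_le_eq)
        then show ?thesis using \<open>\<zeta> > 0\<close> by simp
      next
        case False
        then have "dist (f t) (f x) < \<zeta>" using that r(2) by (auto simp: T_def dist_commute)
        moreover have "0 \<le> C * (cos x - cos t)\<^sup>2" using C(1) by simp
        ultimately show ?thesis by (simp add: dist_real_def)
      qed
      then show ?thesis using that C(1) by (metis less_imp_le)
    qed
    have bound: "\<bar>S N - pi * f x\<bar> \<le> \<zeta> * pi + 4 * C * pi / real N" if "N > 0" for N
    proof -
      have "S N - pi * f x = integral {0..pi} (\<lambda>t. f t * K N t) - integral {0..pi} (\<lambda>t. f x * K N t)"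
        by (simp add: S_def K_mass)
      also have "\<dots> = integral {0..pi} (\<lambda>t. f t * K N t - f x * K N t)"
        by (rule integral_diff[symmetric])
          (intro integrable_continuous_real continuous_intros cont contK)+
      finally have *: "\<bar>S N - pi * f x\<bar> = norm (integral {0..pi} (\<lambda>t. f t * K N t - f x * K N t))"
        by simp
      also have "\<dots> \<le> integral {0..pi} (\<lambda>t. \<zeta> * K N t + C * (4 / real N))"
      proof (rule integral_norm_bound_integral)
        fix t assume t: "t \<in> {0..pi}"
        have "norm (f t * K N t - f x * K N t) = \<bar>f t - f x\<bar> * K N t"
          using K_nonneg[OF that] by (simp add: left_diff_distrib[symmetric] abs_mult)
        also have "\<dots> \<le> (\<zeta> + C * (cos x - cos t)\<^sup>2) * K N t"
          by (intro mult_right_mono C(2) t K_nonneg that)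
        also have "\<dots> = \<zeta> * K N t + C * ((cos x - cos t)\<^sup>2 * K N t)" by (simp add: algebra_simps)
        also have "\<dots> \<le> \<zeta> * K N t + C * (4 / real N)"
          by (intro add_left_mono mult_left_mono K_mom C(1) that)
        finally show "norm (f t * K N t - f x * K N t) \<le> \<zeta> * K N t + C * (4 / real N)" .
      qed (intro integrable_continuous_real continuous_intros cont contK)+
      also have "\<dots> = integral {0..pi} (\<lambda>t. \<zeta> * K N t) + integral {0..pi} (\<lambda>t. C * (4 / real N))"
        by (rule integral_add) (intro integrable_continuous_real continuous_intros contK)+
      also have "\<dots> = \<zeta> * pi + 4 * C * pi / real N" by (simp add: K_mass)
      finally show ?thesis .
    qed
    obtain N0 where N0: "N0 > 0" "real N0 > 8 * C * pi / e"
      by (metis gr0I not_less of_nat_0 reals_Archimedean2 zero_less_Suc less_Suc_eq of_nat_less_iff order_less_trans)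
    show "\<exists>no. \<forall>n\<ge>no. norm (S n - pi * f x) < e"
    proof (intro exI allI impI)
      fix N assume "N \<ge> N0"
      then have N: "N > 0" "real N > 8 * C * pi / e" using N0 by auto
      then have "8 * C * pi < e * real N" using \<open>e > 0\<close> by (simp add: field_simps)
      then have "4 * C * pi / real N < e / 2" using N by (simp add: field_simps)
      moreover have "\<zeta> * pi = e / 2" by (simp add: \<zeta>_def)
      ultimately show "norm (S N - pi * f x) < e" using bound[OF N(1)] by simp
    qed
  qed
  then show ?thesis unfolding S_eq .
qed

section \<open>Power spectrum of a cosine bump\<close>

text \<open>On the circle of length 2, let \<open>H\<close> be the first Dirichlet eigenfunction \<open>cos (\<pi> x / \<tau>)\<close> of
  the interval \<open>[-\<tau>/2, \<tau>/2]\<close>, continued by zero. Up to normalisation \<open>a\<close> is the autocorrelation of \<open>H\<close>,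
  \<open>\<alpha>\<close> its Fourier coefficients (squared moduli of those of \<open>H\<close>, hence non-negative), and \<open>b\<close> is
  \<open>- a'' / \<pi>\<^sup>2\<close>, which has the coefficients \<open>n\<^sup>2 \<alpha>\<^sub>n\<close>. The value \<open>b 0 = 1 / \<tau>\<^sup>2\<close> is the Dirichlet eigenvalue
  \<open>(\<pi> / \<tau>)\<^sup>2\<close> divided by \<open>\<pi>\<^sup>2\<close>.\<close>
lemma cosine_bump_spectrum:
  fixes \<tau> :: real
  assumes \<tau>: "0 < \<tau>" "\<tau> \<le> 1"
  obtains \<alpha> :: "int \<Rightarrow> real" and a b :: "real \<Rightarrow> real" where
    "\<And>n. 0 \<le> \<alpha> n" "\<And>n. \<alpha> (- n) = \<alpha> n"
    "a 0 = 1" "b 0 = 1 / \<tau>\<^sup>2" "\<And>x. \<tau> \<le> \<bar>x\<bar> \<Longrightarrow> a x = 0" "\<And>x. \<tau> \<le> \<bar>x\<bar> \<Longrightarrow> b x = 0"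
    "\<And>x. \<bar>x\<bar> \<le> 1 \<Longrightarrow>
      (\<lambda>N. \<Sum>n=-int N..int N. fejer_weight N n * \<alpha> n * cos (of_int n * (pi * x))) \<longlonglongrightarrow> a x"
    "\<And>x. \<bar>x\<bar> \<le> 1 \<Longrightarrow>
      (\<lambda>N. \<Sum>n=-int N..int N. fejer_weight N n * ((of_int n)\<^sup>2 * \<alpha> n) * cos (of_int n * (pi * x))) \<longlonglongrightarrow> b x"
proof -
  define \<omega> \<delta> where "\<omega> = 1 / \<tau>" and "\<delta> = pi * \<tau>"
  have \<omega>: "\<omega> > 0" and \<delta>: "0 < \<delta>" "\<delta> \<le> pi" and \<omega>\<delta>: "\<omega> * \<delta> = pi"
    using \<tau> by (auto simp: \<omega>_def \<delta>_def)
  \<comment> \<open>In the variable \<open>t = \<pi> x\<close>, \<open>g\<close> is the autocorrelation of \<open>cos (\<omega> t)\<close> on \<open>[-\<delta>/2, \<delta>/2]\<close> for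
    \<open>0 \<le> t \<le> \<delta>\<close>, and \<open>h = - g''\<close>.\<close>
  define g where "g t = (\<delta> - t) / 2 * cos (\<omega> * t) + sin (\<omega> * t) / (2 * \<omega>)" for t
  define g' where "g' t = - (\<omega> / 2) * (\<delta> - t) * sin (\<omega> * t)" for t
  define h where "h t = \<omega>\<^sup>2 / 2 * (\<delta> - t) * cos (\<omega> * t) - \<omega> / 2 * sin (\<omega> * t)" for t
  have g_deriv: "(g has_real_derivative g' t) (at t within S)" for t S
    unfolding g_def g'_def using \<omega> by (auto intro!: derivative_eq_intros simp: field_simps)
  have g'_deriv: "(g' has_real_derivative - h t) (at t within S)" for t S
    unfolding g'_def h_def by (auto intro!: derivative_eq_intros simp: field_simps power2_eq_square)
  have g_ode: "\<omega>\<^sup>2 * g t - h t = \<omega> * sin (\<omega> * t)" for t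
    unfolding g_def h_def using \<omega> by (simp add: field_simps power2_eq_square)
  have ends: "g \<delta> = 0" "h \<delta> = 0" "g' \<delta> = 0" "g' 0 = 0" "g 0 = \<delta> / 2" "h 0 = \<omega>\<^sup>2 * \<delta> / 2"
    using \<omega>\<delta> by (simp_all add: g_def h_def g'_def)
  have cont: "continuous_on S g" "continuous_on S h" for S
    unfolding g_def h_def using \<omega> by (auto intro!: continuous_intros)
  define c where "c n = integral {0..\<delta>} (\<lambda>t. g t * cos (of_int n * t))" for n :: int
  have h_int: "((\<lambda>t. h t * cos (of_int n * t)) has_integral (of_int n)\<^sup>2 * c n) {0..\<delta>}" for n :: int
  proof -
    define G where "G t = - g' t * cos (of_int n * t) - of_int n * g t * sin (of_int n * t)" for t
    have "((\<lambda>t. h t * cos (of_int n * t) - (of_int n)\<^sup>2 * (g t * cos (of_int n * t))) has_integral (G \<delta> - G 0)) {0..\<delta>}"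
      using \<delta> unfolding G_def
      by (intro fundamental_theorem_of_calculus)
        (auto intro!: derivative_eq_intros g_deriv g'_deriv
          simp: has_real_derivative_iff_has_vector_derivative[symmetric] algebra_simps power2_eq_square)
    moreover have "G \<delta> - G 0 = 0" by (simp add: G_def ends)
    ultimately have d1: "((\<lambda>t. h t * cos (of_int n * t) - (of_int n)\<^sup>2 * (g t * cos (of_int n * t))) has_integral 0) {0..\<delta>}"
      by simp
    have d2: "((\<lambda>t. (of_int n)\<^sup>2 * (g t * cos (of_int n * t))) has_integral (of_int n)\<^sup>2 * c n) {0..\<delta>}"
      unfolding c_def
      by (intro has_integral_mult_right integrable_integral integrable_continuous_real continuous_intros cont)
    from has_integral_add[OF d1 d2] show ?thesis by simp
  qed
  have c_nonneg: "0 \<le> c n" for n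
  proof (cases "\<omega>\<^sup>2 = (of_int n)\<^sup>2")
    \<comment> \<open>In the resonant case the integrand is \<open>(\<delta> - t) / 2 * cos\<^sup>2 (\<omega> t)\<close> plus a term with integral zero.\<close>
    case True
    then have cos_eq: "cos (of_int n * t) = cos (\<omega> * t)" for t
      by (auto simp: power2_eq_iff)
    have "((\<lambda>t. sin (\<omega> * t) / (2 * \<omega>) * cos (\<omega> * t)) has_integral
        ((sin (\<omega> * \<delta>))\<^sup>2 / (4 * \<omega>\<^sup>2) - (sin (\<omega> * 0))\<^sup>2 / (4 * \<omega>\<^sup>2))) {0..\<delta>}"
      using \<delta> \<omega> by (intro fundamental_theorem_of_calculus)
        (auto intro!: derivative_eq_intros
          simp: has_real_derivative_iff_has_vector_derivative[symmetric] field_simps power2_eq_square)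
    then have "((\<lambda>t. sin (\<omega> * t) / (2 * \<omega>) * cos (\<omega> * t)) has_integral 0) {0..\<delta>}"
      by (simp add: \<omega>\<delta>)
    moreover have "((\<lambda>t. g t * cos (\<omega> * t)) has_integral c n) {0..\<delta>}"
      unfolding c_def cos_eq by (intro integrable_integral integrable_continuous_real continuous_intros cont)
    ultimately show ?thesis
    proof (rule has_integral_le)
      fix t assume "t \<in> {0..\<delta>}"
      then have "0 \<le> (\<delta> - t) / 2 * (cos (\<omega> * t) * cos (\<omega> * t))"
        by (intro mult_nonneg_nonneg[of "_ / _"]) auto
      then show "sin (\<omega> * t) / (2 * \<omega>) * cos (\<omega> * t) \<le> g t * cos (\<omega> * t)"
        by (simp add: g_def algebra_simps)
    qed
  next
    \<comment> \<open>Otherwise integrate the equation \<open>\<omega>\<^sup>2 g + g'' = \<omega> sin (\<omega> t)\<close> against \<open>cos (n t)\<close>.\<close>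
    case False
    define D where "D = \<omega>\<^sup>2 - (of_int n)\<^sup>2"
    have D: "D \<noteq> 0" using False by (simp add: D_def)
    define S where "S t = - (\<omega> * cos (\<omega> * t) * cos (of_int n * t) + of_int n * sin (\<omega> * t) * sin (of_int n * t))" for t
    have "((\<lambda>t. D * (sin (\<omega> * t) * cos (of_int n * t))) has_integral (S \<delta> - S 0)) {0..\<delta>}"
      using \<delta> unfolding S_def by (intro fundamental_theorem_of_calculus)
        (auto intro!: derivative_eq_intros
          simp: has_real_derivative_iff_has_vector_derivative[symmetric] algebra_simps D_def power2_eq_square)
    from has_integral_mult_right[OF this, of "\<omega> / D"] have "((\<lambda>t. \<omega> / D * (D * (sin (\<omega> * t) * cos (of_int n * t)))) has_integral \<omega> / D * (S \<delta> - S 0)) {0..\<delta>}"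
      .
    moreover have "S \<delta> = \<omega> * cos (of_int n * \<delta>)" "S 0 = - \<omega>" by (simp_all add: S_def \<omega>\<delta>)
    then have "\<omega> / D * (S \<delta> - S 0) = \<omega> * (\<omega> * (1 + cos (of_int n * \<delta>)) / D)" by (simp add: algebra_simps add_divide_distrib)
    moreover have "\<omega> / D * (D * (sin (\<omega> * t) * cos (of_int n * t))) = \<omega> * (sin (\<omega> * t) * cos (of_int n * t))" for t
      using D by simp
    ultimately have "((\<lambda>t. \<omega> * (sin (\<omega> * t) * cos (of_int n * t))) has_integral \<omega> * (\<omega> * (1 + cos (of_int n * \<delta>)) / D)) {0..\<delta>}"
      by (simp only:)
    moreover have "((\<lambda>t. \<omega>\<^sup>2 * (g t * cos (of_int n * t)) - h t * cos (of_int n * t)) has_integral (\<omega>\<^sup>2 * c n - (of_int n)\<^sup>2 * c n)) {0..\<delta>}"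
      unfolding c_def
      by (intro has_integral_diff h_int[unfolded c_def] has_integral_mult_right integrable_integral
          integrable_continuous_real continuous_intros cont)
    moreover have "\<omega>\<^sup>2 * (g t * cos (of_int n * t)) - h t * cos (of_int n * t) = \<omega> * (sin (\<omega> * t) * cos (of_int n * t))" for t
      using g_ode[of t] by (metis left_diff_distrib mult.assoc)
    ultimately have "D * c n = \<omega> * (\<omega> * (1 + cos (of_int n * \<delta>)) / D)"
      by (simp add: D_def left_diff_distrib has_integral_unique)
    then have "c n = \<omega>\<^sup>2 * (1 + cos (of_int n * \<delta>)) / D\<^sup>2"
      using D by (simp add: field_simps power2_eq_square)
    moreover have "0 \<le> 1 + cos (of_int n * \<delta>)" using cos_ge_minus_one[of "of_int n * \<delta>"] by linarith
    ultimately show ?thesis by simp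
  qed
  \<comment> \<open>The functions are continued by zero beyond \<open>\<delta>\<close>, where \<open>g\<close> and \<open>h\<close> vanish.\<close>
  define A B where "A t = g (min t \<delta>)" and "B t = h (min t \<delta>)" for t
  have contAB: "continuous_on {0..pi} A" "continuous_on {0..pi} B"
    unfolding A_def B_def
    using continuous_on_compose2[OF cont(1)[of UNIV], of "{0..pi}" "\<lambda>t. min t \<delta>"]
      continuous_on_compose2[OF cont(2)[of UNIV], of "{0..pi}" "\<lambda>t. min t \<delta>"]
    by (simp_all add: continuous_intros)
  have cut: "integral {0..pi} (\<lambda>t. F (min t \<delta>) * cos (of_int n * t)) = integral {0..\<delta>} (\<lambda>t. F t * cos (of_int n * t))"
    if "F \<delta> = 0" for F and n :: int
  proof -
    have "integral {0..pi} (\<lambda>t. F (min t \<delta>) * cos (of_int n * t))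
      = integral {0..pi} (\<lambda>t. if t \<in> {0..\<delta>} then F t * cos (of_int n * t) else 0)"
      using that by (intro integral_cong) (auto simp: min_def)
    also have "\<dots> = integral ({0..\<delta>} \<inter> {0..pi}) (\<lambda>t. F t * cos (of_int n * t))"
      by (rule integral_restrict_Int)
    also have "{0..\<delta>} \<inter> {0..pi} = {0..\<delta>}" using \<delta> by auto
    finally show ?thesis .
  qed
  have intA: "integral {0..pi} (\<lambda>t. A t * cos (of_int n * t)) = c n" for n :: int
    unfolding A_def c_def by (rule cut) (rule ends)
  have intB: "integral {0..pi} (\<lambda>t. B t * cos (of_int n * t)) = (of_int n)\<^sup>2 * c n" for n :: int
    unfolding B_def using cut[of h n] ends(2) integral_unique[OF h_int] by simp
  define k where "k = 2 / (pi * \<delta>)"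
  have k: "k > 0" using \<delta> by (simp add: k_def)
  show thesis
  proof
    show "0 \<le> k * c n" for n using k c_nonneg by simp
    show "k * c (- n) = k * c n" for n by (simp add: c_def)
    show "k * pi * A (pi * \<bar>0\<bar>) = 1" "k * pi * B (pi * \<bar>0\<bar>) = 1 / \<tau>\<^sup>2"
      using \<delta> by (simp_all add: A_def B_def ends k_def \<omega>_def field_simps)
    show "k * pi * A (pi * \<bar>x\<bar>) = 0" "k * pi * B (pi * \<bar>x\<bar>) = 0" if "\<tau> \<le> \<bar>x\<bar>" for x
      using that by (simp_all add: A_def B_def \<delta>_def min_def ends[unfolded \<delta>_def])
    fix x :: real assume "\<bar>x\<bar> \<le> 1"
    then have x: "pi * \<bar>x\<bar> \<in> {0..pi}" by simp
    have abs: "cos (of_int n * (pi * \<bar>x\<bar>)) = cos (of_int n * (pi * x))" for n :: int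
      by (simp add: abs_if)
    show "(\<lambda>N. \<Sum>n=-int N..int N. fejer_weight N n * (k * c n) * cos (of_int n * (pi * x))) \<longlonglongrightarrow> k * pi * A (pi * \<bar>x\<bar>)"
      using tendsto_mult_left[OF fejer_cosine_series[OF contAB(1) x], of k]
      unfolding intA abs by (simp add: sum_distrib_left mult_ac)
    show "(\<lambda>N. \<Sum>n=-int N..int N. fejer_weight N n * ((of_int n)\<^sup>2 * (k * c n)) * cos (of_int n * (pi * x))) \<longlonglongrightarrow> k * pi * B (pi * \<bar>x\<bar>)"
      using tendsto_mult_left[OF fejer_cosine_series[OF contAB(2) x], of k]
      unfolding intB abs by (simp add: sum_distrib_left mult_ac)
  qed
qed

section \<open>Ingham's inequality for separated points\<close>

lemma sum_cis_symmetric: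
  assumes "\<And>n. g (- n) = g n"
  shows "(\<Sum>n=-int N..int N. complex_of_real (g n) * cis (of_int n * t))
    = complex_of_real (\<Sum>n=-int N..int N. g n * cos (of_int n * t))"
proof -
  have "(\<Sum>n=-int N..int N. g n * sin (of_int n * t)) = (\<Sum>n=-int N..int N. g (- n) * sin (of_int (- n) * t))"
    by (rule sum.reindex_bij_witness[of _ uminus uminus]) auto
  then have "(\<Sum>n=-int N..int N. g n * sin (of_int n * t)) = 0"
    by (simp add: assms sum_negf)
  then show ?thesis by (simp add: complex_eq_iff)
qed

lemma cis_sum: "cis (\<Sum>i\<in>S. f i) = (\<Prod>i\<in>S. cis (f i))"
  by (induction S rule: infinite_finite_induct) (simp_all add: cis_mult[symmetric])

lemma tendsto_fejer_weight: "(\<lambda>N. fejer_weight N n) \<longlonglongrightarrow> 1"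
  using tendsto_diff[OF tendsto_const[of 1] lim_const_over_n[of "\<bar>real_of_int n\<bar>"]]
  by (simp add: fejer_weight_def)

text \<open>With \<open>\<alpha>\<close>, \<open>a\<close>, \<open>b\<close> as in \<open>cosine_bump_spectrum\<close>, consider the weights
  \<open>P n * (\<Prod>i. \<alpha> (n i))\<close> on the lattice of half-integer frequencies \<open>n/2\<close>, where \<open>P n = 1 - |n/2|\<^sup>2/M\<^sup>2\<close>. Their
  Fourier sum at a difference \<open>v\<close> of two points is
  \<open>Q v = (\<Prod>i. a (v\<^sub>i)) - (\<Sum>j. b (v\<^sub>j) (\<Prod>i\<noteq>j. a (v\<^sub>i))) / (4 M\<^sup>2)\<close>, which vanishes as soon as one coordinate
  of \<open>v\<close> has modulus at least \<open>\<tau>\<close>. Thus the quadratic form of these weights is diagonal on a separated set,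
  with the constant \<open>Q 0\<close>. As \<open>P\<close> is non-positive outside the cube, replacing it by its positive part
  enlarges the form and leaves finitely many frequencies. Half-integers suffice because the coordinates
  of the points differ by at most 1, less than the period 2 by at least \<open>\<tau>\<close>. The
  Fourier sums are taken as limits of Fejer means, whose weights lie in \<open>[0, 1]\<close> and hence preserve the
  comparison.\<close>
theorem ingham_weights:
  fixes y :: "'s \<Rightarrow> real ^ 'n::finite" and I :: "'s set"
  assumes "finite I" and M: "M > 0" and \<tau>: "0 < \<tau>" "\<tau> \<le> 1"
    and close: "\<And>k l i. k \<in> I \<Longrightarrow> l \<in> I \<Longrightarrow> \<bar>y k $ i - y l $ i\<bar> \<le> 1"
    and sep: "\<And>k l. k \<in> I \<Longrightarrow> l \<in> I \<Longrightarrow> k \<noteq> l \<Longrightarrow> \<exists>i. \<tau> \<le> \<bar>y k $ i - y l $ i\<bar>"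
  obtains Z :: "('n \<Rightarrow> int) set" and w :: "('n \<Rightarrow> int) \<Rightarrow> real" where
    "finite Z" "\<And>n. n \<in> Z \<Longrightarrow> 0 \<le> w n" "sum w Z \<le> 1" "\<And>n i. n \<in> Z \<Longrightarrow> \<bar>of_int (n i) / 2\<bar> \<le> M"
    "\<And>c. (1 - CARD('n) / (4 * M\<^sup>2 * \<tau>\<^sup>2)) * (\<Sum>k\<in>I. (cmod (c k))\<^sup>2)
      \<le> (\<Sum>n\<in>Z. w n * (cmod (\<Sum>k\<in>I. c k * cis (2 * pi * ((\<chi> i. of_int (n i) / 2) \<bullet> y k))))\<^sup>2)"
proof -
  from cosine_bump_spectrum[OF \<tau>] obtain \<alpha> :: "int \<Rightarrow> real" and a b :: "real \<Rightarrow> real" where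
    \<alpha>: "\<And>n. 0 \<le> \<alpha> n" "\<And>n. \<alpha> (- n) = \<alpha> n"
    and ab0: "a 0 = 1" "b 0 = 1 / \<tau>\<^sup>2"
    and ab_far: "\<And>x. \<tau> \<le> \<bar>x\<bar> \<Longrightarrow> a x = 0" "\<And>x. \<tau> \<le> \<bar>x\<bar> \<Longrightarrow> b x = 0"
    and a_lim: "\<And>x. \<bar>x\<bar> \<le> 1 \<Longrightarrow>
      (\<lambda>N. \<Sum>n=-int N..int N. fejer_weight N n * \<alpha> n * cos (of_int n * (pi * x))) \<longlonglongrightarrow> a x"
    and b_lim: "\<And>x. \<bar>x\<bar> \<le> 1 \<Longrightarrow>
      (\<lambda>N. \<Sum>n=-int N..int N. fejer_weight N n * ((of_int n)\<^sup>2 * \<alpha> n) * cos (of_int n * (pi * x))) \<longlonglongrightarrow> b x"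
    by blast
  define freq :: "('n \<Rightarrow> int) \<Rightarrow> real ^ 'n" where "freq n = (\<chi> i. of_int (n i) / 2)" for n
  define P :: "('n \<Rightarrow> int) \<Rightarrow> real" where "P n = 1 - (\<Sum>i\<in>UNIV. (of_int (n i))\<^sup>2 / (4 * M\<^sup>2))" for n
  define w where "w n = max 0 (P n) * (\<Prod>i\<in>UNIV. \<alpha> (n i))" for n :: "'n \<Rightarrow> int"
  define box :: "nat \<Rightarrow> ('n \<Rightarrow> int) set" where "box N = PiE UNIV (\<lambda>_. {- int N..int N})" for N
  define N0 where "N0 = nat \<lfloor>2 * M\<rfloor>"
  define W where "W N n = (\<Prod>i\<in>UNIV. fejer_weight N (n i))" for N and n :: "'n \<Rightarrow> int"
  have fin_box: "finite (box N)" for N unfolding box_def by (intro finite_PiE) auto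
  have box_iff: "n \<in> box N \<longleftrightarrow> (\<forall>i. \<bar>n i\<bar> \<le> int N)" for n N
  proof -
    have "m \<in> {- int N..int N} \<longleftrightarrow> \<bar>m\<bar> \<le> int N" for m by auto
    then show ?thesis by (simp add: box_def PiE_iff)
  qed
  have w_nonneg: "0 \<le> w n" for n unfolding w_def using \<alpha> by (intro mult_nonneg_nonneg prod_nonneg) auto
  have P_out: "P n \<le> 0" if "n \<notin> box N0" for n
  proof -
    obtain i where "\<bar>n i\<bar> > int N0" using \<open>n \<notin> box N0\<close> by (auto simp: box_iff not_le)
    then have "\<bar>n i\<bar> > \<lfloor>2 * M\<rfloor>" unfolding N0_def by linarith
    then have "2 * M < \<bar>real_of_int (n i)\<bar>" by linarith
    then have "(2 * M)\<^sup>2 \<le> \<bar>real_of_int (n i)\<bar>\<^sup>2" using M by (intro power_mono) auto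
    then have "1 \<le> (real_of_int (n i))\<^sup>2 / (4 * M\<^sup>2)" using M by (simp add: power_mult_distrib)
    also have "\<dots> \<le> (\<Sum>i\<in>UNIV. (of_int (n i))\<^sup>2 / (4 * M\<^sup>2))"
      by (rule member_le_sum) auto
    finally show ?thesis by (simp add: P_def)
  qed
  have w_out: "w n = 0" if "n \<notin> box N0" for n
    using P_out[OF that] by (simp add: w_def max_absorb1)
  have W: "0 \<le> W N n" "W N n \<le> 1" if "n \<in> box N" for N n
  proof -
    have "n i \<in> {- int N..int N}" for i using that unfolding box_def PiE_iff by blast
    from fejer_weight_bounds[OF this] show "0 \<le> W N n" "W N n \<le> 1"
      unfolding W_def by (auto intro!: prod_nonneg prod_le_1)
  qed
  have dominated: "(\<Sum>n\<in>box N. W N n * P n * (\<Prod>i\<in>UNIV. \<alpha> (n i)) * q n) \<le> (\<Sum>n\<in>box N0. w n * q n)"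
    if "\<And>n. 0 \<le> q n" for N q
  proof -
    have "(\<Sum>n\<in>box N. W N n * P n * (\<Prod>i\<in>UNIV. \<alpha> (n i)) * q n) \<le> (\<Sum>n\<in>box N. w n * q n)"
    proof (intro sum_mono mult_right_mono that)
      fix n assume n: "n \<in> box N"
      have "W N n * P n \<le> W N n * max 0 (P n)" using W(1)[OF n] by (intro mult_left_mono) auto
      also have "\<dots> \<le> 1 * max 0 (P n)" using W(2)[OF n] by (intro mult_right_mono) auto
      finally show "W N n * P n * (\<Prod>i\<in>UNIV. \<alpha> (n i)) \<le> w n"
        unfolding w_def using \<alpha> by (intro mult_right_mono prod_nonneg) auto
    qed
    also have "\<dots> = (\<Sum>n\<in>box N \<inter> box N0. w n * q n)"
      using w_out by (intro sum.mono_neutral_right) (auto simp: fin_box)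
    also have "\<dots> \<le> (\<Sum>n\<in>box N0. w n * q n)"
      by (intro sum_mono2) (auto simp: fin_box w_nonneg that)
    finally show ?thesis .
  qed
  define A where "A N x = (\<Sum>n=-int N..int N. complex_of_real (fejer_weight N n * \<alpha> n) * cis (of_int n * (pi * x)))" for N x
  define B where "B N x = (\<Sum>n=-int N..int N. complex_of_real (fejer_weight N n * ((of_int n)\<^sup>2 * \<alpha> n)) * cis (of_int n * (pi * x)))" for N x
  have fw_even: "fejer_weight N (- n) = fejer_weight N n" for N n by (simp add: fejer_weight_def)
  have A_lim: "(\<lambda>N. A N x) \<longlonglongrightarrow> complex_of_real (a x)" if "\<bar>x\<bar> \<le> 1" for x
    unfolding A_def using tendsto_of_real[OF a_lim[OF that], where 'a = complex]
    by (subst sum_cis_symmetric) (auto simp: \<alpha> fw_even)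
  have B_lim: "(\<lambda>N. B N x) \<longlonglongrightarrow> complex_of_real (b x)" if "\<bar>x\<bar> \<le> 1" for x
    unfolding B_def using tendsto_of_real[OF b_lim[OF that], where 'a = complex]
    by (subst sum_cis_symmetric) (auto simp: \<alpha> fw_even)
  define S where "S N v = (\<Sum>n\<in>box N. complex_of_real (W N n * P n * (\<Prod>i\<in>UNIV. \<alpha> (n i))) * cis (2 * pi * (freq n \<bullet> v)))" for N v
  define Q where "Q v = (\<Prod>i\<in>UNIV. a (v $ i)) - (\<Sum>j\<in>UNIV. (\<Prod>i\<in>UNIV. if i = j then b (v $ i) else a (v $ i)) / (4 * M\<^sup>2))" for v :: "real ^ 'n"
  have S_eq: "S N v = (\<Prod>i\<in>UNIV. A N (v $ i))
      - (\<Sum>j\<in>UNIV. (\<Prod>i\<in>UNIV. if i = j then B N (v $ i) else A N (v $ i)) / (4 * complex_of_real M ^ 2))" for N v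
  proof -
    define E where "E n i = complex_of_real (fejer_weight N n * \<alpha> n) * cis (of_int n * (pi * v $ i))" for n i
    have cis_freq: "cis (2 * pi * (freq n \<bullet> v)) = (\<Prod>i\<in>UNIV. cis (of_int (n i) * (pi * v $ i)))" for n
      by (simp add: freq_def inner_vec_def sum_distrib_left cis_sum[symmetric] mult_ac)
    have sq: "complex_of_real ((of_int (n j))\<^sup>2) * (\<Prod>i\<in>UNIV. E (n i) i)
        = (\<Prod>i\<in>UNIV. if i = j then complex_of_real ((of_int (n i))\<^sup>2) * E (n i) i else E (n i) i)" for n j
    proof -
      have "(\<Prod>i\<in>UNIV. if i = j then complex_of_real ((of_int (n i))\<^sup>2) * E (n i) i else E (n i) i)
        = (\<Prod>i\<in>UNIV. (if i = j then complex_of_real ((of_int (n i))\<^sup>2) else 1) * E (n i) i)"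
        by (intro prod.cong) auto
      then show ?thesis by (simp add: prod.distrib)
    qed
    have term_eq: "complex_of_real (W N n * P n * (\<Prod>i\<in>UNIV. \<alpha> (n i))) * cis (2 * pi * (freq n \<bullet> v))
      = (\<Prod>i\<in>UNIV. E (n i) i) - (\<Sum>j\<in>UNIV. (\<Prod>i\<in>UNIV. if i = j then complex_of_real ((of_int (n i))\<^sup>2) * E (n i) i else E (n i) i) / (4 * complex_of_real M ^ 2))" for n
    proof -
      have "complex_of_real (W N n * P n * (\<Prod>i\<in>UNIV. \<alpha> (n i))) * cis (2 * pi * (freq n \<bullet> v))
        = complex_of_real (P n) * (\<Prod>i\<in>UNIV. E (n i) i)"
      proof -
        have "(\<Prod>i\<in>UNIV. E (n i) i) = complex_of_real (W N n * (\<Prod>i\<in>UNIV. \<alpha> (n i))) * cis (2 * pi * (freq n \<bullet> v))"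
          unfolding cis_freq E_def W_def by (simp add: prod.distrib)
        then show ?thesis by (simp add: mult_ac)
      qed
      also have "\<dots> = (\<Prod>i\<in>UNIV. E (n i) i) - (\<Sum>j\<in>UNIV. complex_of_real ((of_int (n j))\<^sup>2) * (\<Prod>i\<in>UNIV. E (n i) i) / (4 * complex_of_real M ^ 2))"
        by (simp add: P_def left_diff_distrib sum_distrib_right)
      finally show ?thesis unfolding sq .
    qed
    have "(\<Sum>n\<in>box N. \<Prod>i\<in>UNIV. E (n i) i) = (\<Prod>i\<in>UNIV. A N (v $ i))"
      unfolding box_def A_def E_def by (rule prod_sum_PiE[symmetric]) auto
    moreover have "(\<Sum>n\<in>box N. \<Prod>i\<in>UNIV. if i = j then complex_of_real ((of_int (n i))\<^sup>2) * E (n i) i else E (n i) i)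
      = (\<Prod>i\<in>UNIV. if i = j then B N (v $ i) else A N (v $ i))" for j
    proof -
      have "(\<Prod>i\<in>UNIV. if i = j then B N (v $ i) else A N (v $ i))
        = (\<Prod>i\<in>UNIV. \<Sum>n=-int N..int N. if i = j then complex_of_real ((of_int n)\<^sup>2) * E n i else E n i)"
        by (intro prod.cong) (auto simp: A_def B_def E_def mult_ac)
      also have "\<dots> = (\<Sum>n\<in>box N. \<Prod>i\<in>UNIV. if i = j then complex_of_real ((of_int (n i))\<^sup>2) * E (n i) i else E (n i) i)"
        unfolding box_def by (rule prod_sum_PiE) auto
      finally show ?thesis by simp
    qed
    ultimately show ?thesis
      unfolding S_def term_eq sum_subtractf
      by (subst sum.swap) (simp add: sum_divide_distrib[symmetric])
  qed
  have S_lim: "(\<lambda>N. S N v) \<longlonglongrightarrow> complex_of_real (Q v)" if "\<And>i. \<bar>v $ i\<bar> \<le> 1" for v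
  proof -
    have "complex_of_real (Q v) = (\<Prod>i\<in>UNIV. complex_of_real (a (v $ i)))
      - (\<Sum>j\<in>UNIV. (\<Prod>i\<in>UNIV. if i = j then complex_of_real (b (v $ i)) else complex_of_real (a (v $ i))) / (4 * complex_of_real M ^ 2))"
      by (simp add: Q_def if_distrib cong: if_cong)
    then show ?thesis
      unfolding S_eq using M
      by (auto intro!: tendsto_intros tendsto_prod A_lim B_lim that)
  qed
  have Q0: "Q 0 = 1 - CARD('n) / (4 * M\<^sup>2 * \<tau>\<^sup>2)"
    by (simp add: Q_def ab0 prod.delta cong: if_cong)
  have Q_far: "Q v = 0" if "\<tau> \<le> \<bar>v $ i\<bar>" for v i
  proof -
    have 1: "(\<Prod>i\<in>UNIV. a (v $ i)) = 0"
      using ab_far(1)[OF that] by (intro prod_zero) auto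
    have 2: "(\<Prod>i\<in>UNIV. if i = j then b (v $ i) else a (v $ i)) = 0" for j
      using ab_far[OF that] by (intro prod_zero) auto
    show ?thesis unfolding Q_def 1 2 by simp
  qed
  show thesis
  proof (rule that[of "box N0" w])
    show "sum w (box N0) \<le> 1"
    proof -
      have sum_le: "(\<Sum>n=-int N0..int N0. \<alpha> n) \<le> 1"
      proof (rule LIMSEQ_le)
        show "(\<lambda>N. \<Sum>n=-int N0..int N0. fejer_weight N n * \<alpha> n) \<longlonglongrightarrow> (\<Sum>n=-int N0..int N0. \<alpha> n)"
        proof -
          have "(\<lambda>N. \<Sum>n=-int N0..int N0. fejer_weight N n * \<alpha> n) \<longlonglongrightarrow> (\<Sum>n=-int N0..int N0. 1 * \<alpha> n)"
            by (intro tendsto_sum tendsto_mult tendsto_fejer_weight tendsto_const)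
          then show ?thesis by simp
        qed
        show "(\<lambda>N. \<Sum>n=-int N..int N. fejer_weight N n * \<alpha> n) \<longlonglongrightarrow> 1"
          using a_lim[of 0] by (simp add: ab0)
        show "\<exists>N. \<forall>n\<ge>N. (\<Sum>k=-int N0..int N0. fejer_weight n k * \<alpha> k) \<le> (\<Sum>k=-int n..int n. fejer_weight n k * \<alpha> k)"
          by (intro exI[of _ N0] allI impI sum_mono2) (auto intro!: mult_nonneg_nonneg fejer_weight_bounds \<alpha>)
      qed
      have "sum w (box N0) \<le> (\<Sum>n\<in>box N0. \<Prod>i\<in>UNIV. \<alpha> (n i))"
      proof (rule sum_mono)
        fix n
        have "P n \<le> 1" unfolding P_def by (simp add: sum_nonneg)
        then have "max 0 (P n) * (\<Prod>i\<in>UNIV. \<alpha> (n i)) \<le> 1 * (\<Prod>i\<in>UNIV. \<alpha> (n i))"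
          using \<alpha> by (intro mult_right_mono prod_nonneg) auto
        then show "w n \<le> (\<Prod>i\<in>UNIV. \<alpha> (n i))" by (simp add: w_def)
      qed
      also have "\<dots> = (\<Prod>i\<in>(UNIV::'n set). \<Sum>n=-int N0..int N0. \<alpha> n)"
        unfolding box_def by (rule prod_sum_PiE[symmetric]) auto
      also have "\<dots> \<le> 1"
        using sum_le \<alpha> by (intro prod_le_1) (auto intro!: sum_nonneg)
      finally show ?thesis .
    qed
    show "\<bar>of_int (n i) / 2\<bar> \<le> M" if "n \<in> box N0" for n i
    proof -
      have "\<bar>n i\<bar> \<le> \<lfloor>2 * M\<rfloor>" using that M by (auto simp: box_iff N0_def)
      then show ?thesis by linarith
    qed
    fix c :: "'s \<Rightarrow> complex"
    define h where "h n = (\<Sum>k\<in>I. c k * cis (2 * pi * (freq n \<bullet> y k)))" for n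
    define F where "F N = (\<Sum>n\<in>box N. W N n * P n * (\<Prod>i\<in>UNIV. \<alpha> (n i)) * (cmod (h n))\<^sup>2)" for N
    have F_eq: "complex_of_real (F N) = (\<Sum>k\<in>I. \<Sum>l\<in>I. c k * cnj (c l) * S N (y k - y l))" for N
    proof -
      have "complex_of_real ((cmod (h n))\<^sup>2) = (\<Sum>k\<in>I. \<Sum>l\<in>I. c k * cnj (c l) * cis (2 * pi * (freq n \<bullet> (y k - y l))))" for n
        unfolding complex_norm_square h_def
        by (simp add: sum_product cis_cnj inner_diff_right right_diff_distrib cis_divide[symmetric] divide_inverse mult_ac)
      then have "complex_of_real (F N) = (\<Sum>n\<in>box N. \<Sum>k\<in>I. \<Sum>l\<in>I. c k * cnj (c l) *
          (complex_of_real (W N n * P n * (\<Prod>i\<in>UNIV. \<alpha> (n i))) * cis (2 * pi * (freq n \<bullet> (y k - y l)))))"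
        unfolding F_def of_real_sum of_real_mult by (simp add: sum_distrib_left mult_ac)
      also have "\<dots> = (\<Sum>k\<in>I. \<Sum>l\<in>I. \<Sum>n\<in>box N. c k * cnj (c l) *
          (complex_of_real (W N n * P n * (\<Prod>i\<in>UNIV. \<alpha> (n i))) * cis (2 * pi * (freq n \<bullet> (y k - y l)))))"
        by (subst sum.swap) (intro sum.cong refl sum.swap)
      finally show ?thesis by (simp only: S_def sum_distrib_left)
    qed
    have "(\<lambda>N. complex_of_real (F N)) \<longlonglongrightarrow> (\<Sum>k\<in>I. \<Sum>l\<in>I. c k * cnj (c l) * complex_of_real (Q (y k - y l)))"
      unfolding F_eq by (intro tendsto_sum tendsto_mult tendsto_const S_lim) (simp add: close)
    also have "(\<Sum>k\<in>I. \<Sum>l\<in>I. c k * cnj (c l) * complex_of_real (Q (y k - y l)))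
      = (\<Sum>k\<in>I. \<Sum>l\<in>I. if l = k then complex_of_real (Q 0 * (cmod (c k))\<^sup>2) else 0)"
    proof (intro sum.cong refl)
      fix k l assume kl: "k \<in> I" "l \<in> I"
      show "c k * cnj (c l) * complex_of_real (Q (y k - y l)) = (if l = k then complex_of_real (Q 0 * (cmod (c k))\<^sup>2) else 0)"
      proof (cases "l = k")
        case False
        then obtain i where "\<tau> \<le> \<bar>(y k - y l) $ i\<bar>" using sep[OF kl] by auto
        from Q_far[OF this] False show ?thesis by simp
      qed (simp add: complex_norm_square[symmetric] del: of_real_power)
    qed
    also have "\<dots> = complex_of_real (Q 0 * (\<Sum>k\<in>I. (cmod (c k))\<^sup>2))"
      using \<open>finite I\<close> by (simp add: sum_distrib_left)
    finally have "F \<longlonglongrightarrow> Q 0 * (\<Sum>k\<in>I. (cmod (c k))\<^sup>2)"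
      by (rule tendsto_of_real_iff[THEN iffD1])
    moreover have "F N \<le> (\<Sum>n\<in>box N0. w n * (cmod (h n))\<^sup>2)" for N
      unfolding F_def by (rule dominated) simp
    ultimately have "Q 0 * (\<Sum>k\<in>I. (cmod (c k))\<^sup>2) \<le> (\<Sum>n\<in>box N0. w n * (cmod (h n))\<^sup>2)"
      by (intro LIMSEQ_le_const2) auto
    then show "(1 - CARD('n) / (4 * M\<^sup>2 * \<tau>\<^sup>2)) * (\<Sum>k\<in>I. (cmod (c k))\<^sup>2)
      \<le> (\<Sum>n\<in>box N0. w n * (cmod (\<Sum>k\<in>I. c k * cis (2 * pi * ((\<chi> i. of_int (n i) / 2) \<bullet> y k))))\<^sup>2)"
      unfolding Q0 h_def freq_def .
  qed (auto simp: fin_box w_nonneg)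
qed

section \<open>Multipliers of exponential sums\<close>

lemma infnorm_le_iff_cart: "infnorm (v :: real ^ 'n::finite) \<le> R \<longleftrightarrow> (\<forall>i. \<bar>v $ i\<bar> \<le> R)"
proof
  assume "infnorm v \<le> R"
  then show "\<forall>i. \<bar>v $ i\<bar> \<le> R" using component_le_infnorm_cart order_trans by blast
next
  assume "\<forall>i. \<bar>v $ i\<bar> \<le> R"
  then show "infnorm v \<le> R" unfolding infnorm_cart by (intro cSup_least) auto
qed

lemma infnorm_attained: "\<exists>i. infnorm (v :: real ^ 'n::finite) = \<bar>v $ i\<bar>"
proof -
  have "Max (range (\<lambda>i. \<bar>v $ i\<bar>)) \<in> range (\<lambda>i. \<bar>v $ i\<bar>)" by (intro Max_in) auto
  then obtain i where i: "Max (range (\<lambda>i. \<bar>v $ i\<bar>)) = \<bar>v $ i\<bar>" by (rule rangeE)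
  have "\<bar>v $ j\<bar> \<le> \<bar>v $ i\<bar>" for j unfolding i[symmetric] by (intro Max_ge) auto
  then have "infnorm v \<le> \<bar>v $ i\<bar>" by (auto simp: infnorm_le_iff_cart)
  then show ?thesis using component_le_infnorm_cart[of v i] by (intro exI[of _ i]) simp
qed

lemma mem_cube: "v \<in> cube R \<longleftrightarrow> infnorm v \<le> R"
  by (simp add: cube_def lp_norm_def)

lemma cube_eq_cbox: "(cube R :: (real ^ 'n::finite) set) = cbox (\<chi> i. - R) (\<chi> i. R)"
  by (auto simp: mem_cube infnorm_le_iff_cart mem_box_cart abs_le_iff minus_le_iff)

lemma fourier_op_cis: "fourier_op x u \<omega> = (\<Sum>k\<in>UNIV. u $ k * cis (- (2 * pi * (\<omega> \<bullet> x k))))"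
  unfolding fourier_op_def by (simp add: cis_conv_exp mult_ac)

definition energy :: "real \<Rightarrow> ('s::finite \<Rightarrow> real ^ 'n::finite) \<Rightarrow> complex ^ 's \<Rightarrow> real" where
  "energy R x u = (LINT \<omega>:cube R|lborel. (cmod (fourier_op x u \<omega>))\<^sup>2)"

lemma continuous_on_fourier_op: "continuous_on S (fourier_op x u)"
  unfolding fourier_op_cis by (intro continuous_intros)

lemma energy_integrable:
  "integrable lborel (\<lambda>\<omega>. indicat_real (cube R) \<omega> * (cmod (fourier_op x u (\<omega> - a)))\<^sup>2)"
proof -
  have "continuous_on (cube R) (\<lambda>\<omega>. (cmod (fourier_op x u (\<omega> - a)))\<^sup>2)"
    by (intro continuous_intros continuous_on_compose2[OF continuous_on_fourier_op[of UNIV]]) auto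
  from borel_integrable_compact[OF _ this] show ?thesis by (simp add: cube_eq_cbox compact_cbox)
qed

lemma L2_norm_eq_sqrt_energy: "L2_norm_on (cube R) (fourier_op x u) = sqrt (energy R x u)"
proof -
  have "(\<lambda>\<omega>. indicat_real (cube R) \<omega> * (cmod (fourier_op x u \<omega>))\<^sup>2) \<in> borel_measurable lborel"
    using energy_integrable[of R x u 0] by (simp add: borel_measurable_integrable)
  then show ?thesis
    unfolding L2_norm_on_def energy_def set_lebesgue_integral_def by (simp add: integral_completion)
qed

lemma energy_shift_le:
  fixes a :: "real ^ 'n::finite"
  assumes "infnorm a \<le> M"
  shows "(\<integral>\<omega>. indicat_real (cube R) \<omega> * (cmod (fourier_op x u (\<omega> - a)))\<^sup>2 \<partial>lborel) \<le> energy (R + M) x u"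
proof -
  define f where "f \<omega> = indicat_real (cube R) \<omega> * (cmod (fourier_op x u (\<omega> - a)))\<^sup>2" for \<omega>
  have f: "integrable lborel f" unfolding f_def by (rule energy_integrable)
  have "integral\<^sup>L lborel f = integral\<^sup>L (distr lborel borel ((+) a)) f"
    by (simp add: lborel_distr_plus)
  also have "\<dots> = (\<integral>\<omega>. f (a + \<omega>) \<partial>lborel)"
    using borel_measurable_integrable[OF f] by (intro integral_distr) auto
  also have "\<dots> \<le> (\<integral>\<omega>. indicat_real (cube (R + M)) \<omega> * (cmod (fourier_op x u (\<omega> - 0)))\<^sup>2 \<partial>lborel)"
  proof (rule integral_mono)
    have "integrable (distr lborel borel ((+) a)) f" using f by (simp add: lborel_distr_plus)
    then show "integrable lborel (\<lambda>\<omega>. f (a + \<omega>))"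
      by (subst (asm) integrable_distr_eq) (use borel_measurable_integrable[OF f] in auto)
    show "f (a + \<omega>) \<le> indicat_real (cube (R + M)) \<omega> * (cmod (fourier_op x u (\<omega> - 0)))\<^sup>2" for \<omega>
    proof -
      have "infnorm \<omega> \<le> infnorm (a + \<omega>) + infnorm (- a)"
        using infnorm_triangle[of "a + \<omega>" "- a"] by simp
      then have "infnorm (a + \<omega>) \<le> R \<Longrightarrow> infnorm \<omega> \<le> R + M"
        using assms by (simp add: infnorm_neg)
      then show ?thesis by (auto simp: f_def mem_cube indicator_def)
    qed
  qed (rule energy_integrable)
  finally show ?thesis by (simp add: energy_def set_lebesgue_integral_def flip: f_def)
qed

lemma energy_mono: "R \<le> R' \<Longrightarrow> energy R x u \<le> energy R' x u"
  using energy_shift_le[of 0 "R' - R" R x u] by (simp add: energy_def set_lebesgue_integral_def infnorm_0)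

lemma energy_nonneg: "0 \<le> energy R x u"
  unfolding energy_def set_lebesgue_integral_def by (intro integral_nonneg_AE) auto

text \<open>The symbol \<open>p\<close> is given by its values at the nodes, since nothing else enters the action on
  coefficient vectors. The inequality holds for every radius \<open>R\<close>, which makes multipliers composable;
  for \<open>R < 0\<close> it is trivial, as the cube is empty.\<close>
definition multiplier :: "('s::finite \<Rightarrow> real ^ 'n::finite) \<Rightarrow> ('s \<Rightarrow> complex) \<Rightarrow> real \<Rightarrow> real \<Rightarrow> bool" where
  "multiplier x p M B \<longleftrightarrow> (\<forall>R u. energy R x (\<chi> k. p k * u $ k) \<le> B\<^sup>2 * energy (R + M) x u)"

lemma multiplier_mono:
  assumes "multiplier x p M B" "M \<le> M'" "0 \<le> B" "B \<le> B'"
  shows "multiplier x p M' B'"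
  unfolding multiplier_def
proof (intro allI)
  fix R u
  have "energy R x (\<chi> k. p k * u $ k) \<le> B\<^sup>2 * energy (R + M) x u"
    using assms by (simp add: multiplier_def)
  also have "\<dots> \<le> B'\<^sup>2 * energy (R + M') x u"
    using assms by (intro mult_mono power_mono energy_mono energy_nonneg) auto
  finally show "energy R x (\<chi> k. p k * u $ k) \<le> B'\<^sup>2 * energy (R + M') x u" .
qed

lemma multiplier_mult:
  assumes "multiplier x p M B" "multiplier x q M' B'"
  shows "multiplier x (\<lambda>k. p k * q k) (M + M') (B * B')"
  unfolding multiplier_def
proof (intro allI)
  fix R u
  let ?v = "\<chi> k. q k * u $ k"
  have "energy R x (\<chi> k. p k * ?v $ k) \<le> B\<^sup>2 * energy (R + M) x ?v"
    using assms(1) unfolding multiplier_def by blast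
  also have "\<dots> \<le> B\<^sup>2 * (B'\<^sup>2 * energy (R + M + M') x u)"
    using assms(2) unfolding multiplier_def by (intro mult_left_mono) auto
  finally show "energy R x (\<chi> k. p k * q k * u $ k) \<le> (B * B')\<^sup>2 * energy (R + (M + M')) x u"
    by (simp add: power_mult_distrib mult.assoc add.assoc)
qed

lemma multiplier_prod:
  assumes "finite J" "\<And>j. j \<in> J \<Longrightarrow> multiplier x (p j) (M j) (B j)"
  shows "multiplier x (\<lambda>k. \<Prod>j\<in>J. p j k) (\<Sum>j\<in>J. M j) (\<Prod>j\<in>J. B j)"
  using assms
proof (induction J rule: finite_induct)
  case empty
  then show ?case by (simp add: multiplier_def)
next
  case (insert j J)
  then show ?case using multiplier_mult[of x "p j" "M j" "B j"] by simp
qed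

text \<open>The action of \<open>p\<close> is a combination of translations of the exponential sum of \<open>u\<close> by the vectors
  \<open>a i\<close>. The Cauchy-Schwarz inequality with respect to the weights \<open>|\<gamma> i|\<close> bounds its square pointwise.\<close>
lemma multiplier_exp_sum:
  fixes x :: "'s::finite \<Rightarrow> real ^ 'n::finite"
  assumes "finite S" and a: "\<And>i. i \<in> S \<Longrightarrow> infnorm (a i) \<le> M"
  shows "multiplier x (\<lambda>k. \<Sum>i\<in>S. \<gamma> i * cis (2 * pi * (a i \<bullet> x k))) M (\<Sum>i\<in>S. cmod (\<gamma> i))"
  unfolding multiplier_def
proof (intro allI)
  fix R and u :: "complex ^ 's"
  define h where "h \<omega> = fourier_op x u \<omega>" for \<omega>
  define v :: "complex ^ 's" where "v = (\<chi> k. (\<Sum>i\<in>S. \<gamma> i * cis (2 * pi * (a i \<bullet> x k))) * u $ k)"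
  define B where "B = (\<Sum>i\<in>S. cmod (\<gamma> i))"
  have shift: "fourier_op x v \<omega> = (\<Sum>i\<in>S. \<gamma> i * h (\<omega> - a i))" for \<omega>
  proof -
    have "cis (- (2 * pi * ((\<omega> - a i) \<bullet> x k))) = cis (2 * pi * (a i \<bullet> x k)) * cis (- (2 * pi * (\<omega> \<bullet> x k)))" for i k
      by (simp add: cis_mult inner_diff_left algebra_simps)
    then have "fourier_op x v \<omega> = (\<Sum>k\<in>UNIV. \<Sum>i\<in>S. \<gamma> i * (u $ k * cis (- (2 * pi * ((\<omega> - a i) \<bullet> x k)))))"
      unfolding fourier_op_cis v_def by (simp add: sum_distrib_left mult_ac)
    also have "\<dots> = (\<Sum>i\<in>S. \<gamma> i * h (\<omega> - a i))"
      by (subst sum.swap) (simp add: h_def fourier_op_cis sum_distrib_left)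
    finally show ?thesis .
  qed
  have pointwise: "(cmod (fourier_op x v \<omega>))\<^sup>2 \<le> B * (\<Sum>i\<in>S. cmod (\<gamma> i) * (cmod (h (\<omega> - a i)))\<^sup>2)" for \<omega>
  proof -
    have "cmod (fourier_op x v \<omega>) \<le> (\<Sum>i\<in>S. sqrt (cmod (\<gamma> i)) * (sqrt (cmod (\<gamma> i)) * cmod (h (\<omega> - a i))))"
      unfolding shift by (rule order_trans[OF norm_sum]) (simp add: norm_mult flip: mult.assoc)
    then have "(cmod (fourier_op x v \<omega>))\<^sup>2 \<le> (\<Sum>i\<in>S. sqrt (cmod (\<gamma> i)) * (sqrt (cmod (\<gamma> i)) * cmod (h (\<omega> - a i))))\<^sup>2"
      by (intro power_mono) auto
    also have "\<dots> \<le> (\<Sum>i\<in>S. (sqrt (cmod (\<gamma> i)))\<^sup>2) * (\<Sum>i\<in>S. (sqrt (cmod (\<gamma> i)) * cmod (h (\<omega> - a i)))\<^sup>2)"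
      by (rule Cauchy_Schwarz_ineq_sum)
    finally show ?thesis by (simp add: B_def power_mult_distrib)
  qed
  have int: "integrable lborel (\<lambda>\<omega>. indicat_real (cube R) \<omega> * (cmod (h (\<omega> - b)))\<^sup>2)" for b
    unfolding h_def by (rule energy_integrable)
  have "energy R x v = (\<integral>\<omega>. indicat_real (cube R) \<omega> * (cmod (fourier_op x v (\<omega> - 0)))\<^sup>2 \<partial>lborel)"
    by (simp add: energy_def set_lebesgue_integral_def)
  also have "\<dots> \<le> (\<integral>\<omega>. B * (\<Sum>i\<in>S. cmod (\<gamma> i) * (indicat_real (cube R) \<omega> * (cmod (h (\<omega> - a i)))\<^sup>2)) \<partial>lborel)"
  proof (rule integral_mono)
    fix \<omega>
    have "indicat_real (cube R) \<omega> * (cmod (fourier_op x v \<omega>))\<^sup>2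
      \<le> indicat_real (cube R) \<omega> * (B * (\<Sum>i\<in>S. cmod (\<gamma> i) * (cmod (h (\<omega> - a i)))\<^sup>2))"
      using pointwise by (intro mult_left_mono) auto
    then show "indicat_real (cube R) \<omega> * (cmod (fourier_op x v (\<omega> - 0)))\<^sup>2
      \<le> B * (\<Sum>i\<in>S. cmod (\<gamma> i) * (indicat_real (cube R) \<omega> * (cmod (h (\<omega> - a i)))\<^sup>2))"
      by (simp add: sum_distrib_left mult_ac)
  qed (intro energy_integrable integrable_mult_right Bochner_Integration.integrable_sum int)+
  also have "\<dots> = B * (\<Sum>i\<in>S. cmod (\<gamma> i) * (\<integral>\<omega>. indicat_real (cube R) \<omega> * (cmod (h (\<omega> - a i)))\<^sup>2 \<partial>lborel))"
    using int by (simp add: Bochner_Integration.integral_sum)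
  also have "\<dots> \<le> B * (\<Sum>i\<in>S. cmod (\<gamma> i) * energy (R + M) x u)"
    unfolding h_def
    by (intro mult_left_mono sum_mono energy_shift_le a) (auto simp: B_def sum_nonneg)
  also have "\<dots> = B\<^sup>2 * energy (R + M) x u"
    by (simp add: B_def power2_eq_square mult.assoc flip: sum_distrib_right)
  finally show "energy R x (\<chi> k. (\<Sum>i\<in>S. \<gamma> i * cis (2 * pi * (a i \<bullet> x k))) * u $ k)
    \<le> (\<Sum>i\<in>S. cmod (\<gamma> i))\<^sup>2 * energy (R + M) x u"
    by (simp add: v_def B_def)
qed

lemma coefficient_le_energy:
  fixes x :: "'s::finite \<Rightarrow> real ^ 'n::finite"
  assumes "multiplier x p M B" "p k = 1" "\<And>l. l \<noteq> k \<Longrightarrow> p l = 0"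
  shows "(cmod (u $ k))\<^sup>2 * measure lebesgue (cube R :: (real ^ 'n) set) \<le> B\<^sup>2 * energy (R + M) x u"
proof -
  let ?v = "\<chi> l. p l * u $ l"
  have "fourier_op x ?v \<omega> = u $ k * cis (- (2 * pi * (\<omega> \<bullet> x k)))" for \<omega>
  proof -
    have "fourier_op x ?v \<omega> = (\<Sum>l\<in>UNIV. if l = k then u $ k * cis (- (2 * pi * (\<omega> \<bullet> x k))) else 0)"
      unfolding fourier_op_cis using assms(2,3) by (intro sum.cong) auto
    then show ?thesis by simp
  qed
  then have "energy R x ?v = (\<integral>\<omega>. indicat_real (cube R) \<omega> * (cmod (u $ k))\<^sup>2 \<partial>(lborel :: (real ^ 'n) measure))"
    by (simp add: energy_def set_lebesgue_integral_def norm_mult)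
  also have "\<dots> = (cmod (u $ k))\<^sup>2 * measure lebesgue (cube R :: (real ^ 'n) set)"
    by (simp add: cube_eq_cbox)
  finally show ?thesis using assms(1) unfolding multiplier_def by metis
qed

section \<open>Sine multipliers\<close>

lemma sine_multiplier:
  fixes x :: "'s::finite \<Rightarrow> real ^ 'n::finite"
  assumes "infnorm a \<le> M" "\<sigma> \<noteq> 0"
  shows "multiplier x (\<lambda>k. complex_of_real (sin (2 * pi * (a \<bullet> x k) - b) / \<sigma>)) M (1 / \<bar>\<sigma>\<bar>)"
proof -
  define \<gamma> where "\<gamma> i = (if i then cis (- b) else - cis b) / (2 * \<i> * complex_of_real \<sigma>)" for i
  define v where "v i = (if i then a else - a)" for i
  have "multiplier x (\<lambda>k. \<Sum>i\<in>UNIV. \<gamma> i * cis (2 * pi * (v i \<bullet> x k))) M (\<Sum>i\<in>UNIV. cmod (\<gamma> i))"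
    using assms by (intro multiplier_exp_sum) (auto simp: v_def infnorm_neg)
  moreover have "(\<Sum>i\<in>UNIV. cmod (\<gamma> i)) = 1 / \<bar>\<sigma>\<bar>"
    by (simp add: UNIV_bool \<gamma>_def norm_divide norm_mult)
  moreover have "(\<Sum>i\<in>UNIV. \<gamma> i * cis (2 * pi * (v i \<bullet> x k))) = complex_of_real (sin (2 * pi * (a \<bullet> x k) - b) / \<sigma>)" for k
  proof -
    have euler: "complex_of_real (sin t) = (cis t - cis (- t)) / (2 * \<i>)" for t
      by (simp add: complex_eq_iff)
    have "complex_of_real (sin (2 * pi * (a \<bullet> x k) - b) / \<sigma>)
      = (cis (2 * pi * (a \<bullet> x k) - b) - cis (b - 2 * pi * (a \<bullet> x k))) / (2 * \<i> * complex_of_real \<sigma>)"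
      by (simp only: of_real_divide euler divide_divide_eq_left minus_diff_eq)
    also have "cis (2 * pi * (a \<bullet> x k) - b) = cis (- b) * cis (2 * pi * (a \<bullet> x k))"
      by (simp add: cis_mult)
    also have "cis (b - 2 * pi * (a \<bullet> x k)) = cis b * cis (2 * pi * (- a \<bullet> x k))"
      by (simp add: cis_mult)
    finally show ?thesis
      by (simp add: UNIV_bool \<gamma>_def v_def diff_divide_distrib)
  qed
  ultimately show ?thesis by simp
qed

lemma sin_pi_ge:
  assumes "0 \<le> t" "t \<le> 1 / 2"
  shows "2 * t \<le> sin (pi * t)"
proof -
  have "convex_on {0..1/2} (\<lambda>t. - sin (pi * t))"
  proof (rule f''_ge0_imp_convex)
    fix t :: real assume t: "t \<in> {0..1/2}"
    show "((\<lambda>t. - sin (pi * t)) has_real_derivative - (pi * cos (pi * t))) (at t)"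
      by (auto intro!: derivative_eq_intros)
    show "((\<lambda>t. - (pi * cos (pi * t))) has_real_derivative pi\<^sup>2 * sin (pi * t)) (at t)"
      by (auto intro!: derivative_eq_intros simp: power2_eq_square)
    have "pi * t \<le> pi * 1" using t by (intro mult_left_mono) auto
    then show "0 \<le> pi\<^sup>2 * sin (pi * t)" using t by (intro mult_nonneg_nonneg sin_ge_zero) auto
  qed auto
  from convex_onD_Icc'[OF this, of t] assms show ?thesis by simp
qed

text \<open>The symbol is a sine in the normal direction with a zero on \<open>H\<close>. Its frequency is the largest one
  within the band \<open>M\<close>, unless the node \<open>x k0\<close> is so far from \<open>H\<close> that a lower frequency already puts the
  maximum of the sine at that node.\<close>
lemma hyperplane_multiplier:
  fixes x :: "'s::finite \<Rightarrow> real ^ 'n::finite"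
  assumes "hyperplane H" "x k0 \<notin> H" "0 < \<eta>" "\<eta> \<le> infdist (x k0) H" "0 < M" "4 * M * \<eta> \<le> 1"
  obtains p where "p k0 = 1" "\<And>k. x k \<in> H \<Longrightarrow> p k = 0" "multiplier x p M (1 / (4 * M * \<eta>))"
proof -
  obtain a b where a: "a \<noteq> 0" and H: "H = {y. a \<bullet> y = b}" using assms(1) by (auto simp: hyperplane_def)
  define n where "n = a /\<^sub>R norm a"
  define t where "t = n \<bullet> x k0 - b / norm a"
  have n: "norm n = 1" using a by (simp add: n_def)
  have H_n: "y \<in> H \<longleftrightarrow> n \<bullet> y = b / norm a" for y
    using a by (simp add: H n_def field_simps)
  have "x k0 - t *\<^sub>R n \<in> H"
    using n by (simp add: H_n inner_diff_right t_def dot_square_norm)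
  then have "infdist (x k0) H \<le> dist (x k0) (x k0 - t *\<^sub>R n)" by (rule infdist_le)
  then have t: "\<eta> \<le> \<bar>t\<bar>" using assms(4) n by (simp add: dist_norm)
  define c where "c = min (2 * M) (1 / (2 * \<bar>t\<bar>))"
  have c: "0 < c" "c \<le> 2 * M" "c * \<bar>t\<bar> \<le> 1 / 2"
    using t assms by (auto simp: c_def min_def field_simps)
  define \<sigma> where "\<sigma> = sin (pi * c * t)"
  have "2 * (c * \<bar>t\<bar>) \<le> sin (pi * (c * \<bar>t\<bar>))" using c by (intro sin_pi_ge) auto
  also have "\<dots> \<le> \<bar>\<sigma>\<bar>" by (cases "t \<ge> 0") (auto simp: \<sigma>_def mult.assoc)
  finally have "2 * (c * \<bar>t\<bar>) \<le> \<bar>\<sigma>\<bar>" .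
  moreover have "4 * M * \<eta> \<le> 2 * (c * \<bar>t\<bar>)"
  proof (cases "2 * M \<le> 1 / (2 * \<bar>t\<bar>)")
    case True
    then show ?thesis using t assms by (simp add: c_def)
  next
    case False
    then have "2 * (c * \<bar>t\<bar>) = 1" using t assms by (simp add: c_def)
    then show ?thesis using assms by simp
  qed
  ultimately have \<sigma>: "4 * M * \<eta> \<le> \<bar>\<sigma>\<bar>" by linarith
  have pos: "0 < 4 * M * \<eta>" using assms by simp
  define p where "p k = complex_of_real (sin (2 * pi * ((c / 2) *\<^sub>R n \<bullet> x k) - pi * c * (b / norm a)) / \<sigma>)" for k
  show thesis
  proof
    have at_k0: "2 * pi * ((c / 2) *\<^sub>R n \<bullet> x k0) - pi * c * (b / norm a) = pi * c * t"
      by (simp add: t_def algebra_simps)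
    have "\<sigma> \<noteq> 0" using \<sigma> pos by linarith
    then show "p k0 = 1" unfolding p_def at_k0 \<sigma>_def[symmetric] by simp
    show "p k = 0" if "x k \<in> H" for k
      using that unfolding p_def by (simp add: H_n)
    have "infnorm ((c / 2) *\<^sub>R n) \<le> M"
      using infnorm_le_norm[of "(c / 2) *\<^sub>R n"] n c by simp
    then have mult: "multiplier x p M (1 / \<bar>\<sigma>\<bar>)"
      unfolding p_def using \<sigma> pos by (intro sine_multiplier) auto
    have "1 / \<bar>\<sigma>\<bar> \<le> 1 / (4 * M * \<eta>)" using \<sigma> pos by (intro divide_left_mono) auto
    from multiplier_mono[OF mult order_refl _ this] show "multiplier x p M (1 / (4 * M * \<eta>))" by simp
  qed
qed

text \<open>A quarter of a period fits between the nodes in the coordinate where they differ most, so the sine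
  attains its maximum at \<open>x k0\<close> and nothing is lost in the bound.\<close>
lemma point_multiplier:
  fixes x :: "'s::finite \<Rightarrow> real ^ 'n::finite"
  assumes "0 < M" "1 / (4 * M) \<le> infnorm (x k - x k0)"
  obtains p where "p k0 = 1" "p k = 0" "multiplier x p M 1"
proof -
  obtain i where i: "infnorm (x k - x k0) = \<bar>(x k - x k0) $ i\<bar>"
    using infnorm_attained[of "x k - x k0"] by (rule exE)
  define t where "t = x k0 $ i - x k $ i"
  have "0 < 1 / (4 * M)" using assms by simp
  then have t: "1 / (4 * M) \<le> \<bar>t\<bar>" "0 < \<bar>t\<bar>" using assms i by (auto simp: t_def abs_minus_commute)
  define a :: "real ^ 'n" where "a = axis i (1 / (4 * t))"
  have a: "infnorm a \<le> M"
    unfolding infnorm_le_iff_cart a_def using t assms by (auto simp: axis_def field_simps)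
  define b where "b = 2 * pi * (a \<bullet> x k)"
  have a_inner: "a \<bullet> y = y $ i / (4 * t)" for y by (simp add: a_def inner_axis')
  have "2 * pi * (a \<bullet> x k0) - b = 2 * pi * (t / (4 * t))"
    unfolding b_def a_inner t_def by (simp only: right_diff_distrib diff_divide_distrib)
  then have at_k0: "2 * pi * (a \<bullet> x k0) - b = pi / 2" using t by simp
  define p where "p l = complex_of_real (sin (2 * pi * (a \<bullet> x l) - b) / 1)" for l
  show thesis
  proof
    show "p k0 = 1" unfolding p_def at_k0 by simp
    show "p k = 0" by (simp add: p_def b_def)
    show "multiplier x p M 1" unfolding p_def using sine_multiplier[OF a, of 1 x b] by simp
  qed
qed

section \<open>Interpolation on separated nodes\<close>

text \<open>The symbol is \<open>p = \<Sum>n. w\<^sub>n h\<^sub>n e\<^bsup>-2\<pi>i f\<^sub>n\<cdot>x\<^esup>\<close> with \<open>h\<^sub>n = \<Sum>k\<in>I. c\<^sub>k e\<^bsup>2\<pi>i f\<^sub>n\<cdot>x\<^sub>k\<^esup>\<close>, that is, \<open>p\<close> is the Gram matrix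
  of the weights \<open>w\<close> of \<open>ingham_weights\<close> applied to \<open>c\<close>. This matrix has the lower bound
  \<open>\<mu> = 1 - d / (4 M\<^sup>2 \<tau>\<^sup>2)\<close>, so \<open>c\<close> can be chosen to make \<open>p\<close> a unit vector on \<open>I\<close>. Then
  \<open>\<Sum>n. w\<^sub>n |h\<^sub>n|\<^sup>2\<close> equals the entry of \<open>c\<close> at \<open>k0\<close>, at most \<open>1 / \<mu>\<close>, and as the weights have mass at most 1
  the Cauchy-Schwarz inequality gives \<open>\<Sum>n. w\<^sub>n |h\<^sub>n| \<le> 1 / sqrt \<mu>\<close>.\<close>
theorem separated_interpolation:
  fixes x :: "'s::finite \<Rightarrow> real ^ 'n::finite"
  assumes k0: "k0 \<in> I" and M: "M > 0" and \<tau>: "0 < \<tau>" "\<tau> \<le> 1"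
    and close: "\<And>k l i. k \<in> I \<Longrightarrow> l \<in> I \<Longrightarrow> \<bar>x k $ i - x l $ i\<bar> \<le> 1"
    and sep: "\<And>k l. k \<in> I \<Longrightarrow> l \<in> I \<Longrightarrow> k \<noteq> l \<Longrightarrow> \<tau> \<le> infnorm (x k - x l)"
    and small: "CARD('n) / (4 * M\<^sup>2 * \<tau>\<^sup>2) < 1"
  obtains p where "p k0 = 1" "\<And>k. k \<in> I \<Longrightarrow> k \<noteq> k0 \<Longrightarrow> p k = 0"
    "multiplier x p M (1 / sqrt (1 - CARD('n) / (4 * M\<^sup>2 * \<tau>\<^sup>2)))"
proof -
  define \<mu> where "\<mu> = 1 - CARD('n) / (4 * M\<^sup>2 * \<tau>\<^sup>2)"
  have mu: "\<mu> > 0" using small by (simp add: \<mu>_def)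
  have sep': "\<exists>i. \<tau> \<le> \<bar>x k $ i - x l $ i\<bar>" if "k \<in> I" "l \<in> I" "k \<noteq> l" for k l
    using sep[OF that] infnorm_attained[of "x k - x l"] by auto
  show thesis
  proof (rule ingham_weights[where y = x and I = I and M = M and \<tau> = \<tau>])
    show "finite I" "0 < M" "0 < \<tau>" "\<tau> \<le> 1" using M \<tau> by simp_all
    show "\<bar>x k $ i - x l $ i\<bar> \<le> 1" if "k \<in> I" "l \<in> I" for k l i using that by (rule close)
    show "\<exists>i. \<tau> \<le> \<bar>x k $ i - x l $ i\<bar>" if "k \<in> I" "l \<in> I" "k \<noteq> l" for k l using that by (rule sep')
    fix Z :: "('n \<Rightarrow> int) set" and w :: "('n \<Rightarrow> int) \<Rightarrow> real"
    assume Z: "finite Z" and w: "\<And>n. n \<in> Z \<Longrightarrow> 0 \<le> w n" "sum w Z \<le> 1"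
      and freq: "\<And>n i. n \<in> Z \<Longrightarrow> \<bar>of_int (n i) / 2\<bar> \<le> M"
      and ingham: "\<And>c. (1 - CARD('n) / (4 * M\<^sup>2 * \<tau>\<^sup>2)) * (\<Sum>k\<in>I. (cmod (c k))\<^sup>2)
        \<le> (\<Sum>n\<in>Z. w n * (cmod (\<Sum>k\<in>I. c k * cis (2 * pi * ((\<chi> i. of_int (n i) / 2) \<bullet> x k))))\<^sup>2)"
    define f :: "('n \<Rightarrow> int) \<Rightarrow> real ^ 'n" where "f n = (\<chi> i. of_int (n i) / 2)" for n
    define h where "h c n = (\<Sum>k\<in>I. c $ k * cis (2 * pi * (f n \<bullet> x k)))" for c :: "complex ^ 's" and n
    define E where "E c = (\<Sum>n\<in>Z. w n * (cmod (h c n))\<^sup>2)" for c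
    have coercive: "\<mu> * (\<Sum>k\<in>I. (cmod (c $ k))\<^sup>2) \<le> E c" for c
      unfolding \<mu>_def E_def h_def f_def by (rule ingham)
    define G where "G c k = (\<Sum>n\<in>Z. complex_of_real (w n) * h c n * cis (2 * pi * (- f n \<bullet> x k)))" for c k
    have form: "(\<Sum>k\<in>I. cnj (c $ k) * G c k) = complex_of_real (E c)" for c
    proof -
      have "(\<Sum>k\<in>I. cnj (c $ k) * G c k) = (\<Sum>n\<in>Z. \<Sum>k\<in>I. complex_of_real (w n) * (h c n * (cnj (c $ k) * cis (2 * pi * (- f n \<bullet> x k)))))"
        unfolding G_def sum_distrib_left by (subst sum.swap) (simp add: mult_ac)
      also have "\<dots> = (\<Sum>n\<in>Z. complex_of_real (w n) * (h c n * cnj (h c n)))"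
        by (simp add: h_def[of c] cis_cnj flip: sum_distrib_left)
      finally show ?thesis by (simp add: E_def complex_norm_square[symmetric] del: of_real_power)
    qed
    \<comment> \<open>The Gram matrix, extended by the identity outside \<open>I\<close> to an endomorphism of the whole space.\<close>
    define \<Phi> where "\<Phi> c = (\<chi> k. if k \<in> I then G c k else c $ k)" for c :: "complex ^ 's"
    have "linear \<Phi>"
    proof (rule linearI)
      have h_add: "h (c + c') n = h c n + h c' n" for c c' n by (simp add: h_def ring_distribs sum.distrib)
      have h_scale: "h (r *\<^sub>R c) n = complex_of_real r * h c n" for r c n
        by (simp add: h_def sum_distrib_left scaleR_conv_of_real[where 'a = complex] mult_ac)
      show "\<Phi> (c + c') = \<Phi> c + \<Phi> c'" for c c'
        by (simp add: \<Phi>_def G_def vec_eq_iff h_add ring_distribs sum.distrib)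
      show "\<Phi> (r *\<^sub>R c) = r *\<^sub>R \<Phi> c" for r c
        by (simp add: \<Phi>_def G_def vec_eq_iff h_scale sum_distrib_left scaleR_conv_of_real[where 'a = complex] mult_ac)
    qed
    moreover have "inj \<Phi>"
    proof (subst linear_injective_0[OF \<open>linear \<Phi>\<close>], intro allI impI)
      fix c assume c: "\<Phi> c = 0"
      have zero: "\<Phi> c $ k = 0" for k using c by simp
      have c': "G c k = 0" if "k \<in> I" for k
        using zero[of k] that by (simp add: \<Phi>_def)
      have c'': "c $ k = 0" if "k \<notin> I" for k
        using zero[of k] that by (simp add: \<Phi>_def)
      have "complex_of_real (E c) = 0" unfolding form[symmetric] using c' by simp
      then have "\<mu> * (\<Sum>k\<in>I. (cmod (c $ k))\<^sup>2) \<le> 0" using coercive[of c] by simp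
      then have "(\<Sum>k\<in>I. (cmod (c $ k))\<^sup>2) \<le> 0" using mu by (simp add: mult_le_0_iff)
      then have "(\<Sum>k\<in>I. (cmod (c $ k))\<^sup>2) = 0" by (intro antisym sum_nonneg) auto
      then have "c $ k = 0" if "k \<in> I" for k using that by (simp add: sum_nonneg_eq_0_iff)
      with c'' show "c = 0" by (auto simp: vec_eq_iff)
    qed
    ultimately have "surj \<Phi>" by (rule linear_inj_imp_surj)
    then obtain c where c: "\<Phi> c = axis k0 1" by (metis surjD)
    have entry: "\<Phi> c $ k = (if k = k0 then 1 else 0)" for k by (simp add: c axis_def)
    have G_c: "G c k = (if k = k0 then 1 else 0)" if "k \<in> I" for k
      using entry[of k] that by (simp add: \<Phi>_def)
    have "complex_of_real (E c) = (\<Sum>k\<in>I. if k = k0 then cnj (c $ k0) else 0)"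
      unfolding form[symmetric] using G_c by (intro sum.cong) auto
    also have "\<dots> = cnj (c $ k0)" using k0 by simp
    finally have E_c: "E c \<le> cmod (c $ k0)"
      by (metis abs_ge_self complex_mod_cnj norm_of_real)
    have "\<mu> * (cmod (c $ k0))\<^sup>2 \<le> \<mu> * (\<Sum>k\<in>I. (cmod (c $ k))\<^sup>2)"
      using mu k0 by (intro mult_left_mono member_le_sum) auto
    then have "\<mu> * (cmod (c $ k0) * cmod (c $ k0)) \<le> cmod (c $ k0)"
      using coercive[of c] E_c by (simp add: power2_eq_square)
    then have "cmod (c $ k0) \<le> 1 / \<mu>"
      using mu by (cases "cmod (c $ k0) = 0") (simp_all add: field_simps)
    then have E_le: "E c \<le> 1 / \<mu>" using E_c by linarith
    define \<gamma> where "\<gamma> n = complex_of_real (w n) * h c n" for n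
    have "(\<Sum>n\<in>Z. cmod (\<gamma> n)) = (\<Sum>n\<in>Z. sqrt (w n) * (sqrt (w n) * cmod (h c n)))"
      using w(1) by (intro sum.cong) (auto simp: \<gamma>_def norm_mult simp flip: mult.assoc)
    then have "(\<Sum>n\<in>Z. cmod (\<gamma> n))\<^sup>2 \<le> (\<Sum>n\<in>Z. (sqrt (w n))\<^sup>2) * (\<Sum>n\<in>Z. (sqrt (w n) * cmod (h c n))\<^sup>2)"
      by (simp only: Cauchy_Schwarz_ineq_sum)
    also have "\<dots> = sum w Z * E c"
      using w(1) unfolding E_def by (intro arg_cong2[where f = "(*)"] sum.cong) (auto simp: power_mult_distrib)
    also have "\<dots> \<le> 1 * (1 / \<mu>)"
      using w E_le mu by (intro mult_mono) (auto simp: E_def intro!: sum_nonneg)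
    finally have "(\<Sum>n\<in>Z. cmod (\<gamma> n)) \<le> sqrt (1 / \<mu>)" by (intro real_le_rsqrt) simp
    then have B: "(\<Sum>n\<in>Z. cmod (\<gamma> n)) \<le> 1 / sqrt \<mu>" by (simp add: real_sqrt_divide)
    have "infnorm (- f n) \<le> M" if "n \<in> Z" for n
      using freq[OF that] by (simp add: infnorm_neg infnorm_le_iff_cart f_def)
    then have "multiplier x (\<lambda>k. \<Sum>n\<in>Z. \<gamma> n * cis (2 * pi * (- f n \<bullet> x k))) M (\<Sum>n\<in>Z. cmod (\<gamma> n))"
      by (intro multiplier_exp_sum Z)
    from multiplier_mono[OF this order_refl _ B] have "multiplier x (G c) M (1 / sqrt \<mu>)"
      unfolding G_def \<gamma>_def by (simp add: sum_nonneg)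
    then show thesis using that[of "G c"] G_c k0 by (simp add: \<mu>_def)
  qed
qed

section \<open>Annihilating all nodes but one\<close>

lemma greedy_coloring:
  assumes "finite V" and sym: "\<And>v w. adj v w \<Longrightarrow> adj w v"
    and "\<And>v. v \<in> V \<Longrightarrow> card {w \<in> V. w \<noteq> v \<and> adj v w} < n"
  shows "\<exists>col. (\<forall>v\<in>V. col v < (n::nat)) \<and> (\<forall>v\<in>V. \<forall>w\<in>V. v \<noteq> w \<longrightarrow> adj v w \<longrightarrow> col v \<noteq> col w)"
  using assms(1,3)
proof (induction V rule: finite_induct)
  case (insert u V)
  have deg: "card {w \<in> V. w \<noteq> v \<and> adj v w} < n" if "v \<in> V" for v
  proof (rule le_less_trans)
    show "card {w \<in> V. w \<noteq> v \<and> adj v w} \<le> card {w \<in> insert u V. w \<noteq> v \<and> adj v w}"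
      using insert.hyps(1) by (intro card_mono) auto
    show "card {w \<in> insert u V. w \<noteq> v \<and> adj v w} < n" by (rule insert.prems) (simp add: that)
  qed
  have "\<exists>col. (\<forall>v\<in>V. col v < n) \<and> (\<forall>v\<in>V. \<forall>w\<in>V. v \<noteq> w \<longrightarrow> adj v w \<longrightarrow> col v \<noteq> col w)"
    by (rule insert.IH) (rule deg)
  then obtain col where col: "\<forall>v\<in>V. col v < n"
    "\<forall>v\<in>V. \<forall>w\<in>V. v \<noteq> w \<longrightarrow> adj v w \<longrightarrow> col v \<noteq> col w"
    by (elim exE conjE)
  define N where "N = {w \<in> V. adj u w}"
  have "finite N" using insert.hyps by (simp add: N_def)
  have "N = {w \<in> insert u V. w \<noteq> u \<and> adj u w}"
    using insert.hyps(2) by (auto simp: N_def)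
  also have "card \<dots> < n" by (rule insert.prems) simp
  finally have "card (col ` N) < card {..<n}"
    using card_image_le[OF \<open>finite N\<close>, of col] by simp
  then have "\<not> {..<n} \<subseteq> col ` N"
    using card_mono[OF finite_imageI[OF \<open>finite N\<close>, of col], of "{..<n}"] by linarith
  then obtain j where j: "j < n" "j \<notin> col ` N" by auto
  have new: "col w \<noteq> j" if "w \<in> V" "adj u w" for w
  proof
    assume "col w = j"
    then have "j \<in> col ` N" using that by (intro image_eqI[of _ _ w]) (simp_all add: N_def)
    with j(2) show False ..
  qed
  define col' where "col' = col(u := j)"
  have old: "v \<noteq> u" "col' v = col v" if "v \<in> V" for v
    using that insert.hyps(2) by (auto simp: col'_def)
  have col'_u: "col' u = j" by (simp add: col'_def)
  show ?case
  proof (intro exI[of _ col'] conjI ballI impI)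
    fix v assume "v \<in> insert u V"
    then show "col' v < n" using col(1) j(1) old(2) col'_u by (elim insertE) simp_all
  next
    fix v w assume vw: "v \<in> insert u V" "w \<in> insert u V" "v \<noteq> w" "adj v w"
    consider "v = u" "w \<in> V" | "w = u" "v \<in> V" | "v \<in> V" "w \<in> V" using vw(1-3) by blast
    then show "col' v \<noteq> col' w"
    proof cases
      case 1
      then show ?thesis using new[of w] vw(4) old(2)[of w] col'_u by metis
    next
      case 2
      then show ?thesis using new[of v] sym[OF vw(4)] old(2)[of v] col'_u by metis
    next
      case 3
      then show ?thesis using col(2) vw(3,4) old(2) by metis
    qed
  qed
qed simp

text \<open>The Taylor polynomial of degree 2 is just enough here: \<open>1 + \<epsilon> - 7/2 \<epsilon>\<^sup>2\<close> has its positive zero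
  slightly above \<open>25/36\<close>, which in turn exceeds \<open>ln 2\<close>.\<close>
lemma four_square_le_exp:
  assumes "0 \<le> \<epsilon>" "\<epsilon> \<le> ln (2::real)"
  shows "4 * \<epsilon>\<^sup>2 \<le> exp \<epsilon>" "2 * \<epsilon>\<^sup>2 < 1"
proof -
  have \<epsilon>: "\<epsilon> \<le> 25 / 36" using assms ln2_le_25_over_36 by linarith
  then have sq: "\<epsilon>\<^sup>2 \<le> 25 / 36 * \<epsilon>"
    using assms mult_right_mono[of \<epsilon> "25 / 36" \<epsilon>] by (simp add: power2_eq_square)
  then show "2 * \<epsilon>\<^sup>2 < 1" using \<epsilon> by linarith
  have "1 + \<epsilon> + \<epsilon>\<^sup>2 / 2 \<le> exp \<epsilon>" using assms by (intro exp_lower_Taylor_quadratic)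
  then show "4 * \<epsilon>\<^sup>2 \<le> exp \<epsilon>" using sq \<epsilon> by linarith
qed

lemma powr_half_nat:
  assumes "0 \<le> D" "n > 0"
  shows "D powr (real n / 2) = sqrt D ^ n"
proof (cases "D = 0")
  case False
  then have "D powr (real n / 2) = (D powr (1 / 2)) powr real n" by (simp add: powr_powr)
  also have "\<dots> = sqrt D ^ n" using assms False by (simp add: powr_half_sqrt powr_realpow)
  finally show ?thesis .
qed (use assms in simp)

text \<open>The three kinds of nodes use the bands \<open>r m / (2 r + 2)\<close> (hyperplanes), at most \<open>(\<nu> - 1) m / (4 \<nu>)\<close>
  (single nodes) and \<open>m / (2 \<nu>) + (\<nu> - 1) m / (4 \<nu>)\<close> (colour classes); the last two add up to \<open>m / 2\<close>.
  The quantity \<open>\<theta>\<close> is \<open>d / (4 M\<^sup>2 \<tau>\<^sup>2)\<close> for \<open>M = m / (2 \<nu>)\<close>, and \<open>4 \<theta>\<close> is its value for \<open>M = m / (4 \<nu>)\<close>.\<close>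
theorem annihilating_multiplier:
  fixes x :: "'s::finite \<Rightarrow> real ^ 'n::finite" and m \<tau> \<eta> :: real and \<nu> r :: nat
  defines "\<theta> \<equiv> CARD('n) * (\<nu> / (m * \<tau>))\<^sup>2"
  assumes "inj x" and close: "\<And>k l i. \<bar>x k $ i - x l $ i\<bar> \<le> 1"
    and m: "m > 0" and \<tau>: "0 < \<tau>" "\<tau> \<le> 1"
    and \<nu>: "\<nu> = local_sparsity \<infinity> \<tau> (range x)"
    and hyp: "locally_hyperplanes \<infinity> (real \<nu> / m) r \<eta> (range x)"
    and \<eta>: "\<eta> \<le> (real r + 1) / (2 * m)"
    and small: "4 * \<theta> < 1"
  obtains p where "p k0 = 1" "\<And>k. k \<noteq> k0 \<Longrightarrow> p k = 0"
    "multiplier x p (m / 2 + real r * (m / (2 * real r + 2)))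
      ((1 / (2 * m * \<eta> / (real r + 1))) ^ r * (1 / sqrt (1 - \<theta>) * (1 / sqrt (1 - 4 * \<theta>)) ^ (\<nu> - 1)))"
proof -
  have card_near: "card {l. infnorm (x l - x k) \<le> \<tau>} \<le> \<nu>" for k
  proof -
    have "lp_nbhd \<infinity> (x k) \<tau> (range x) = x ` {l. infnorm (x l - x k) \<le> \<tau>}"
      by (auto simp: lp_nbhd_def lp_norm_def)
    then have "card (lp_nbhd \<infinity> (x k) \<tau> (range x)) = card {l. infnorm (x l - x k) \<le> \<tau>}"
      using \<open>inj x\<close> by (simp add: card_image inj_on_subset)
    moreover have "card (lp_nbhd \<infinity> (x k) \<tau> (range x)) \<le> \<nu>"
      unfolding \<nu> local_sparsity_def by (intro Max_ge) auto
    ultimately show ?thesis by simp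
  qed
  have card_adj: "card {l \<in> UNIV. l \<noteq> k \<and> infnorm (x l - x k) \<le> \<tau>} < \<nu>" for k
  proof -
    have "k \<in> {l. infnorm (x l - x k) \<le> \<tau>}" using \<tau> by (simp add: infnorm_0)
    then have "card ({l. infnorm (x l - x k) \<le> \<tau>} - {k}) < card {l. infnorm (x l - x k) \<le> \<tau>}"
      by (intro card_Diff1_less) auto
    moreover have "{l \<in> UNIV. l \<noteq> k \<and> infnorm (x l - x k) \<le> \<tau>} = {l. infnorm (x l - x k) \<le> \<tau>} - {k}"
      by blast
    ultimately have "card {l \<in> UNIV. l \<noteq> k \<and> infnorm (x l - x k) \<le> \<tau>} < card {l. infnorm (x l - x k) \<le> \<tau>}"
      by simp
    with card_near[of k] show ?thesis by linarith
  qed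
  have \<nu>_pos: "\<nu> > 0" using card_adj[of k0] by linarith

  \<comment> \<open>Nodes on the hyperplanes. Fewer than \<open>r\<close> of them only help, because \<open>\<kappa> \<le> 1\<close>.\<close>
  obtain q H where "q \<le> r" and H: "consists_of_hyperplanes q H (x k0) (lp_nbhd \<infinity> (x k0) (real \<nu> / m) (range x))"
    and H_dist: "\<forall>i\<in>{1..q}. \<eta> \<le> infdist (x k0) (H i)" and "\<eta> > 0"
    using hyp unfolding locally_hyperplanes_def by blast
  define R where "R = m / (2 * real r + 2)"
  define \<kappa> where "\<kappa> = 2 * m * \<eta> / (real r + 1)"
  have R: "R > 0" using m by (simp add: R_def)
  have \<kappa>_R: "\<kappa> = 4 * R * \<eta>" by (simp add: \<kappa>_def R_def field_simps)
  have \<kappa>: "0 < \<kappa>" "\<kappa> \<le> 1" using m \<open>\<eta> > 0\<close> \<eta> by (simp_all add: \<kappa>_def field_simps)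
  have "\<exists>p. p k0 = 1 \<and> (\<forall>k. x k \<in> H i \<longrightarrow> p k = 0) \<and> multiplier x p R (1 / \<kappa>)" if "i \<in> {1..q}" for i
  proof (rule hyperplane_multiplier[of "H i" x k0 \<eta> R])
    show "hyperplane (H i)" "x k0 \<notin> H i" using H that by (auto simp: consists_of_hyperplanes_def)
    show "\<eta> \<le> infdist (x k0) (H i)" using H_dist that by blast
    show "4 * R * \<eta> \<le> 1" using \<kappa> by (simp add: \<kappa>_R)
  qed (use R \<open>\<eta> > 0\<close> in \<open>auto simp: \<kappa>_R\<close>)
  then obtain pH where pH: "\<And>i. i \<in> {1..q} \<Longrightarrow> pH i k0 = 1"
    "\<And>i k. i \<in> {1..q} \<Longrightarrow> x k \<in> H i \<Longrightarrow> pH i k = 0" "\<And>i. i \<in> {1..q} \<Longrightarrow> multiplier x (pH i) R (1 / \<kappa>)"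
    by metis
  have "multiplier x (\<lambda>k. \<Prod>i\<in>{1..q}. pH i k) (\<Sum>i\<in>{1..q}. R) (\<Prod>i\<in>{1..q}. 1 / \<kappa>)"
    using pH(3) by (intro multiplier_prod) auto
  then have "multiplier x (\<lambda>k. \<Prod>i\<in>{1..q}. pH i k) (q * R) ((1 / \<kappa>) ^ q)" by simp
  moreover have "q * R \<le> r * R" "(1 / \<kappa>) ^ q \<le> (1 / \<kappa>) ^ r" "0 \<le> (1 / \<kappa>) ^ q"
    using \<open>q \<le> r\<close> R \<kappa> by (auto intro!: mult_right_mono power_increasing)
  ultimately have multH: "multiplier x (\<lambda>k. \<Prod>i\<in>{1..q}. pH i k) (r * R) ((1 / \<kappa>) ^ r)"
    using multiplier_mono by blast

  \<comment> \<open>Nodes at intermediate distance, one sine each.\<close>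
  define J where "J = {l \<in> UNIV. l \<noteq> k0 \<and> infnorm (x l - x k0) \<le> \<tau> \<and> real \<nu> / m < infnorm (x l - x k0)}"
  define M where "M = m / (4 * \<nu>)"
  have M: "M > 0" using m \<nu>_pos by (simp add: M_def)
  have "card J \<le> card {l \<in> UNIV. l \<noteq> k0 \<and> infnorm (x l - x k0) \<le> \<tau>}"
    unfolding J_def by (intro card_mono) auto
  then have card_J: "card J \<le> \<nu> - 1" using card_adj[of k0] by linarith
  have "\<exists>p. p k0 = 1 \<and> p l = 0 \<and> multiplier x p M 1" if "l \<in> J" for l
  proof (rule point_multiplier[of M x l k0])
    show "1 / (4 * M) \<le> infnorm (x l - x k0)" using that m \<nu>_pos by (simp add: J_def M_def)
  qed (use M in auto)
  then obtain pJ where pJ: "\<And>l. l \<in> J \<Longrightarrow> pJ l k0 = 1" "\<And>l. l \<in> J \<Longrightarrow> pJ l l = 0"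
    "\<And>l. l \<in> J \<Longrightarrow> multiplier x (pJ l) M 1"
    by metis
  have "multiplier x (\<lambda>k. \<Prod>l\<in>J. pJ l k) (\<Sum>l\<in>J. M) (\<Prod>l\<in>J. 1)"
    using pJ(3) by (intro multiplier_prod) auto
  then have "multiplier x (\<lambda>k. \<Prod>l\<in>J. pJ l k) (card J * M) 1" by simp
  moreover have "card J * M \<le> (\<nu> - 1) * M" using card_J M by (intro mult_right_mono) auto
  ultimately have multJ: "multiplier x (\<lambda>k. \<Prod>l\<in>J. pJ l k) ((\<nu> - 1) * M) 1"
    using multiplier_mono by fastforce

  \<comment> \<open>Distant nodes: each class contains \<open>x k0\<close> and the nodes of one colour farther than \<open>\<tau>\<close> from it.\<close>
  have "\<exists>col. (\<forall>v\<in>UNIV. col v < \<nu>) \<and> (\<forall>v\<in>UNIV. \<forall>w\<in>UNIV. v \<noteq> w \<longrightarrow> infnorm (x w - x v) \<le> \<tau> \<longrightarrow> col v \<noteq> col w)"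
    using card_adj by (intro greedy_coloring) (auto simp: infnorm_sub)
  then obtain col where col: "\<And>v. col v < \<nu>"
    "\<And>v w. v \<noteq> w \<Longrightarrow> infnorm (x w - x v) \<le> \<tau> \<Longrightarrow> col v \<noteq> col w"
    by auto
  define I where "I j = insert k0 {l. col l = j \<and> \<tau> < infnorm (x l - x k0)}" for j
  \<comment> \<open>The colour 0 is the class with the doubled band.\<close>
  define N :: "nat \<Rightarrow> real" where "N j = (if j = 0 then 2 * M else M)" for j
  define b where "b j = (if j = 0 then 1 / sqrt (1 - \<theta>) else 1 / sqrt (1 - 4 * \<theta>))" for j :: nat
  have b_N: "1 / sqrt (1 - CARD('n) / (4 * (N j)\<^sup>2 * \<tau>\<^sup>2)) = b j" "CARD('n) / (4 * (N j)\<^sup>2 * \<tau>\<^sup>2) < 1" for j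
  proof -
    have "CARD('n) / (4 * (N j)\<^sup>2 * \<tau>\<^sup>2) = (if j = 0 then \<theta> else 4 * \<theta>)"
      using m \<tau> \<nu>_pos by (simp add: N_def M_def \<theta>_def field_simps power2_eq_square)
    moreover have "0 \<le> \<theta>" by (simp add: \<theta>_def)
    ultimately show "1 / sqrt (1 - CARD('n) / (4 * (N j)\<^sup>2 * \<tau>\<^sup>2)) = b j" "CARD('n) / (4 * (N j)\<^sup>2 * \<tau>\<^sup>2) < 1"
      using small by (simp_all add: b_def)
  qed
  have "\<exists>p. p k0 = 1 \<and> (\<forall>k\<in>I j. k \<noteq> k0 \<longrightarrow> p k = 0) \<and> multiplier x p (N j) (b j)" for j
  proof (rule separated_interpolation[of k0 "I j" "N j" \<tau> x])
    show "k0 \<in> I j" by (simp add: I_def)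
    show "\<tau> \<le> infnorm (x k - x l)" if "k \<in> I j" "l \<in> I j" "k \<noteq> l" for k l
      using that col(2)[of l k] infnorm_sub[of "x k" "x l"] unfolding I_def
      by (cases "\<tau> \<le> infnorm (x k - x l)") auto
  qed (use M \<tau> close b_N in \<open>auto simp: N_def\<close>)
  then obtain pI where pI: "\<And>j. pI j k0 = 1" "\<And>j k. k \<in> I j \<Longrightarrow> k \<noteq> k0 \<Longrightarrow> pI j k = 0"
    "\<And>j. multiplier x (pI j) (N j) (b j)"
    by metis
  have "multiplier x (\<lambda>k. \<Prod>j<\<nu>. pI j k) (\<Sum>j<\<nu>. N j) (\<Prod>j<\<nu>. b j)"
    using pI(3) by (intro multiplier_prod) auto
  moreover obtain \<nu>' where \<nu>': "\<nu> = Suc \<nu>'" using \<nu>_pos gr0_implies_Suc by blast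
  have "(\<Sum>j<\<nu>. N j) = 2 * M + (\<nu> - 1) * M" "(\<Prod>j<\<nu>. b j) = 1 / sqrt (1 - \<theta>) * (1 / sqrt (1 - 4 * \<theta>)) ^ (\<nu> - 1)"
    unfolding \<nu>' sum.lessThan_Suc_shift prod.lessThan_Suc_shift by (simp_all add: N_def b_def)
  ultimately have multI: "multiplier x (\<lambda>k. \<Prod>j<\<nu>. pI j k) (2 * M + (\<nu> - 1) * M)
      (1 / sqrt (1 - \<theta>) * (1 / sqrt (1 - 4 * \<theta>)) ^ (\<nu> - 1))"
    by simp

  define p where "p k = (\<Prod>i\<in>{1..q}. pH i k) * ((\<Prod>l\<in>J. pJ l k) * (\<Prod>j<\<nu>. pI j k))" for k
  show thesis
  proof
    show "p k0 = 1" by (simp add: p_def pH pJ pI)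
    show "p k = 0" if "k \<noteq> k0" for k
    proof -
      consider "infnorm (x k - x k0) \<le> real \<nu> / m" | "real \<nu> / m < infnorm (x k - x k0)" "infnorm (x k - x k0) \<le> \<tau>"
        | "\<tau> < infnorm (x k - x k0)" by linarith
      then show ?thesis
      proof cases
        case 1
        then have "x k \<in> lp_nbhd \<infinity> (x k0) (real \<nu> / m) (range x) - {x k0}"
          using that \<open>inj x\<close> by (auto simp: lp_nbhd_def lp_norm_def inj_eq)
        then obtain i where i: "i \<in> {1..q}" "x k \<in> H i" using H unfolding consists_of_hyperplanes_def by blast
        then have "(\<Prod>i\<in>{1..q}. pH i k) = 0" using pH(2)[OF i] by (intro prod_zero) blast+
        then show ?thesis by (simp add: p_def)
      next
        case 2
        then have "(\<Prod>l\<in>J. pJ l k) = 0" using pJ(2) that by (intro prod_zero) (auto simp: J_def)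
        then show ?thesis by (simp add: p_def)
      next
        case 3
        then have "pI (col k) k = 0" using that by (intro pI(2)) (auto simp: I_def)
        then have "(\<Prod>j<\<nu>. pI j k) = 0" using col(1) by (intro prod_zero) auto
        then show ?thesis by (simp add: p_def)
      qed
    qed
    have "multiplier x p (r * R + ((\<nu> - 1) * M + (2 * M + (\<nu> - 1) * M)))
      ((1 / \<kappa>) ^ r * (1 * (1 / sqrt (1 - \<theta>) * (1 / sqrt (1 - 4 * \<theta>)) ^ (\<nu> - 1))))"
      unfolding p_def by (intro multiplier_mult multH multJ multI)
    moreover have "r * R + ((\<nu> - 1) * M + (2 * M + (\<nu> - 1) * M)) = m / 2 + real r * (m / (2 * real r + 2))"
    proof -
      have "4 * (real \<nu> * M) = m" using \<nu>_pos by (simp add: M_def)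
      moreover have "real \<nu> = real \<nu>' + 1" by (simp add: \<nu>')
      ultimately have "\<nu>' * M + (2 * M + \<nu>' * M) = m / 2" by (simp add: algebra_simps)
      then show ?thesis by (simp add: \<nu>' R_def)
    qed
    ultimately show "multiplier x p (m / 2 + real r * (m / (2 * real r + 2)))
      ((1 / (2 * m * \<eta> / (real r + 1))) ^ r * (1 / sqrt (1 - \<theta>) * (1 / sqrt (1 - 4 * \<theta>)) ^ (\<nu> - 1)))"
      by (simp add: \<kappa>_def)
  qed
qed

section \<open>The lower bound for the least singular value\<close>

theorem theorem4p3:
  fixes x :: "'s::finite \<Rightarrow> real ^ 'n::finite"
    and X :: "(real ^ 'n) set"
    and \<beta> m \<tau> \<eta> :: real
    and s \<nu> r :: nat
  assumes "CARD('n) \<ge> 2"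
    and "\<beta> \<ge> 1 / (2 * ln 2)"
    and "inj x" and "X = range x" and "s = CARD('s)"
    and "\<forall>y\<in>X. \<forall>i. -1/2 \<le> y $ i \<and> y $ i < 1/2"
    and "m \<ge> 4 * real s"
    and "0 < \<tau>" and "\<tau> \<le> 1 / (4 * real CARD('n))"
    and "\<nu> = local_sparsity \<infinity> \<tau> X"
    and "2 * \<beta> * real CARD('n) * real \<nu> / \<tau> \<le> m"
    and "locally_hyperplanes \<infinity> (real \<nu> / m) r \<eta> X"
    and "\<eta> \<le> (real r + 1) / (2 * m)"
  shows "sigma_min (cube m) x \<ge>
           sqrt (2 / real s)
           * (1 - 1/2 * exp (1 / (2 * \<beta>))) powr (real \<nu> / 2)
           * sqrt (measure lebesgue (cube (m / (2 * real r + 2)) :: (real ^ 'n) set))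
           * (1 / 2 powr (real r / 2))
           * (2 * m * \<eta> / (real r + 1)) ^ r"
proof -
  define d where "d = real CARD('n)"
  have d: "d \<ge> 2" using assms(1) by (simp add: d_def)
  have s: "real s > 0" using assms(5) by simp
  have m: "m > 0" using assms(7) s by linarith
  have "1 / (4 * d) \<le> 1" using d by simp
  then have \<tau>: "0 < \<tau>" "\<tau> \<le> 1" using assms(8,9) unfolding d_def by linarith+
  have "\<eta> > 0" using assms(12) by (simp add: locally_hyperplanes_def)
  have close: "\<bar>x k $ i - x l $ i\<bar> \<le> 1" for k l i
  proof -
    have "-1/2 \<le> x k $ i" "x k $ i < 1/2" "-1/2 \<le> x l $ i" "x l $ i < 1/2" using assms(4,6) by auto
    then show ?thesis by linarith
  qed
  have \<nu>_pos: "\<nu> > 0"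
  proof -
    fix k :: 's
    have "x k \<in> lp_nbhd \<infinity> (x k) \<tau> X" using assms(4) \<tau> by (simp add: lp_nbhd_def lp_norm_def infnorm_0)
    moreover have "finite (lp_nbhd \<infinity> (x k) \<tau> X)" using assms(4) by (simp add: lp_nbhd_def)
    ultimately have "0 < card (lp_nbhd \<infinity> (x k) \<tau> X)" using card_gt_0_iff by blast
    also have "\<dots> \<le> \<nu>" unfolding assms(10) local_sparsity_def using assms(4) by (intro Max_ge) auto
    finally show ?thesis .
  qed

  define \<epsilon> where "\<epsilon> = d * real \<nu> / (m * \<tau>)"
  have "\<beta> > 0" using assms(2) by (smt (verit) divide_pos_pos ln_gt_zero_iff)
  have \<epsilon>: "0 \<le> \<epsilon>" "\<epsilon> \<le> 1 / (2 * \<beta>)"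
    using assms(11) m \<tau> d \<open>\<beta> > 0\<close> by (simp_all add: \<epsilon>_def d_def field_simps)
  have \<beta>: "1 / (2 * \<beta>) \<le> ln 2" using assms(2) \<open>\<beta> > 0\<close> by (simp add: field_simps)
  define D where "D = 1 - 1/2 * exp (1 / (2 * \<beta>))"
  have "exp (1 / (2 * \<beta>)) \<le> exp (ln 2)" using \<beta> by (simp only: exp_le_cancel_iff)
  then have D: "0 \<le> D" by (simp add: D_def)
  define \<theta> where "\<theta> = CARD('n) * (\<nu> / (m * \<tau>))\<^sup>2"
  have "\<theta> = \<epsilon>\<^sup>2 / d" using d by (simp add: \<theta>_def \<epsilon>_def d_def power2_eq_square field_simps)
  also have "\<dots> \<le> \<epsilon>\<^sup>2 / 2" using d by (intro divide_left_mono) auto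
  finally have \<theta>: "\<theta> \<le> \<epsilon>\<^sup>2 / 2" .
  have \<epsilon>_ln: "\<epsilon> \<le> ln 2" using \<epsilon> \<beta> by linarith
  have exp_\<epsilon>: "exp \<epsilon> \<le> exp (1 / (2 * \<beta>))" using \<epsilon> by simp
  have small: "4 * \<theta> < 1" using four_square_le_exp(2)[OF \<epsilon>(1) \<epsilon>_ln] \<theta> by linarith
  have \<theta>1: "D \<le> 1 - 4 * \<theta>"
    using four_square_le_exp(1)[OF \<epsilon>(1) \<epsilon>_ln] \<theta> exp_\<epsilon> unfolding D_def by linarith
  have \<theta>0: "2 * D \<le> 1 - \<theta>"
  proof -
    have "1 + \<theta> \<le> exp \<epsilon>" using exp_lower_Taylor_quadratic[OF \<epsilon>(1)] \<epsilon>(1) \<theta> by linarith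
    then have "1 + \<theta> \<le> exp (1 / (2 * \<beta>))" using exp_\<epsilon> by linarith
    then show ?thesis by (simp add: D_def)
  qed

  define \<kappa> where "\<kappa> = 2 * m * \<eta> / (real r + 1)"
  have \<kappa>: "0 < \<kappa>" using m \<open>\<eta> > 0\<close> by (simp add: \<kappa>_def)
  \<comment> \<open>\<open>B\<close> is compared with \<open>1 / g\<close> in the form \<open>g * B \<le> 1\<close>, since \<open>D\<close> and with it \<open>g\<close> may vanish.\<close>
  define B where "B = (1 / \<kappa>) ^ r * (1 / sqrt (1 - \<theta>) * (1 / sqrt (1 - 4 * \<theta>)) ^ (\<nu> - 1))"
  define V where "V = measure lebesgue (cube (m / (2 * real r + 2)) :: (real ^ 'n) set)"
  define g where "g = sqrt 2 * sqrt D ^ \<nu> * \<kappa> ^ r"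
  have "0 \<le> V" by (simp add: V_def)
  have "0 \<le> g" using D \<kappa> by (simp add: g_def)
  have "0 \<le> \<theta>" by (simp add: \<theta>_def)
  have "0 \<le> B" using small \<open>0 \<le> \<theta>\<close> \<kappa> by (simp add: B_def)
  have gB: "g * B \<le> 1"
  proof -
    obtain \<nu>' where \<nu>': "\<nu> = Suc \<nu>'" using \<nu>_pos gr0_implies_Suc by blast
    have "g * B = (\<kappa> * (1 / \<kappa>)) ^ r * (sqrt (2 * D) / sqrt (1 - \<theta>)) * (sqrt D / sqrt (1 - 4 * \<theta>)) ^ \<nu>'"
      by (simp add: g_def B_def \<nu>' real_sqrt_mult power_divide power_mult_distrib mult_ac)
    also have "\<dots> = (sqrt (2 * D) / sqrt (1 - \<theta>)) * (sqrt D / sqrt (1 - 4 * \<theta>)) ^ \<nu>'"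
      using \<kappa> by simp
    also have "\<dots> \<le> 1 * 1 ^ \<nu>'"
      using \<theta>0 \<theta>1 small \<open>0 \<le> \<theta>\<close> D by (intro mult_mono power_mono) (auto simp: divide_le_eq_1)
    finally show ?thesis by simp
  qed

  have "compact (cube m :: (real ^ 'n) set)" by (simp add: cube_eq_cbox compact_cbox)
  from sigma_min_attained(1)[OF this, of x] obtain u :: "complex ^ 's"
    where u: "norm u = 1" "sigma_min (cube m) x = sqrt (energy m x u)"
    unfolding L2_norm_eq_sqrt_energy by blast
  have coeff: "(cmod (u $ k))\<^sup>2 * V \<le> B\<^sup>2 * energy m x u" for k
  proof (rule annihilating_multiplier[of x m \<tau> \<nu> r \<eta> k])
    fix p assume p: "p k = 1" "\<And>l. l \<noteq> k \<Longrightarrow> p l = 0"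
      "multiplier x p (m / 2 + real r * (m / (2 * real r + 2)))
      ((1 / (2 * m * \<eta> / (real r + 1))) ^ r * (1 / sqrt (1 - real CARD('n) * (real \<nu> / (m * \<tau>))\<^sup>2)
        * (1 / sqrt (1 - 4 * (real CARD('n) * (real \<nu> / (m * \<tau>))\<^sup>2))) ^ (\<nu> - 1)))"
    have band: "m / (2 * real r + 2) + (m / 2 + real r * (m / (2 * real r + 2))) = m"
    proof -
      define R where "R = m / (2 * real r + 2)"
      have "(2 * real r + 2) * R = m" by (simp add: R_def add_nonneg_eq_0_iff)
      then show ?thesis unfolding R_def[symmetric] by (simp add: algebra_simps)
    qed
    from coefficient_le_energy[OF p(3,1,2), of u "m / (2 * real r + 2)"]
    show ?thesis unfolding band V_def B_def \<kappa>_def \<theta>_def by simp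
  qed (use assms m \<tau> close small in \<open>auto simp: \<theta>_def\<close>)
  have "V = (\<Sum>k\<in>UNIV. (cmod (u $ k))\<^sup>2) * V"
    using u(1) by (simp add: norm_vec_def L2_set_def real_sqrt_eq_1_iff)
  also have "\<dots> = (\<Sum>k\<in>UNIV. (cmod (u $ k))\<^sup>2 * V)" by (simp add: sum_distrib_right)
  also have "\<dots> \<le> (\<Sum>k\<in>(UNIV::'s set). B\<^sup>2 * energy m x u)" by (intro sum_mono coeff)
  also have "\<dots> = s * (B\<^sup>2 * energy m x u)" using assms(5) by simp
  finally have "V / s \<le> B\<^sup>2 * energy m x u" using s by (simp add: field_simps)
  then have "sqrt (V / s) \<le> B * sqrt (energy m x u)"
    using \<open>0 \<le> B\<close> real_sqrt_le_mono by (fastforce simp: real_sqrt_mult)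
  then have "g * sqrt (V / s) \<le> g * (B * sqrt (energy m x u))"
    using \<open>0 \<le> g\<close> by (intro mult_left_mono)
  also have "\<dots> \<le> sqrt (energy m x u)"
    using mult_right_mono[OF gB, of "sqrt (energy m x u)"] by (simp add: energy_nonneg mult.assoc)
  finally have bound: "g * sqrt (V / s) \<le> sigma_min (cube m) x" by (simp add: u)
  have "sqrt (2 / real s) * D powr (real \<nu> / 2) * sqrt V * (1 / 2 powr (real r / 2)) * \<kappa> ^ r
    = g * sqrt (V / s) * (1 / 2 powr (real r / 2))"
    by (simp add: powr_half_nat[OF D \<nu>_pos] g_def real_sqrt_divide mult_ac)
  also have "\<dots> \<le> g * sqrt (V / s) * 1"
    using \<open>0 \<le> g\<close> \<open>0 \<le> V\<close> by (intro mult_left_mono) (auto simp: ge_one_powr_ge_zero)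
  finally show ?thesis using bound unfolding D_def V_def \<kappa>_def by linarith
qed

end
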